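(* Let $r:[\underline{\tau},\overline{\tau}]\to\mathbb{R}^2$ be a $C^4$-class curve satisfying the standing assumptions in the context. For arbitrary $n\ge 2$ and $0<\delta\le\min\{|\underline{\tau}|,\overline{\tau}\}$ define the probability distribution $\zeta_{n,\delta}$ in the following way: choose $n$ points $\tau_1,\tau_2,\ldots,\tau_n$ independently and using the uniform distribution on $[-\delta,\delta]$, label the points such that $\tau_1\le\tau_2\le\ldots\le\tau_n$, and set $Q^n=\bigcup_{i=1}^{n-1}[r(\tau_i),r(\tau_{i+1})]$. Then $\zeta_{n,\delta}$ is defined by letting $p(\zeta_{n,\delta}=k)$ be the probability that $Q^n$ has exactly $k$ stable equilibria with respect to $o$, where $k=0,1,\ldots,n-1$. Then, for every $\varepsilon>0$ there is some $\delta=\delta(r,n,\varepsilon)>0$ such that $$\left|E(\zeta_{n,\delta})-\frac{1}{\lambda}\left(1-\frac{1}{(1+\lambda)^{n-1}}\right)\right|<\varepsilon,$$ where $\lambda=|1+\kappa\rho|$ and $E$ denotes expected value.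
   Context: Standing assumptions. The reference point $o$ is the origin of $\mathbb{R}^2$. $r(\tau)=(x(\tau),y(\tau))$, $\tau\in[\underline{\tau},\overline{\tau}]$ with $\underline{\tau}<0<\overline{\tau}$, is a simple curve with $\dot{x}>0$. An equilibrium point of $r$ with respect to $o$ is a point $r(\tau)$ with $\langle r(\tau),\dot r(\tau)\rangle=0$. The curve has exactly one equilibrium point $m$ with respect to $o$, and $m=r(0)=(0,\rho)$ with $\rho>0$. The signed curvature $\kappa$ of $r$ at $m$ (the sign being such that $\kappa=f''(0)$ if the curve is written near $m$ as a graph $y=f(x)$) satisfies $0\neq 1+\kappa\rho<1$. A polygonal curve $\bigcup_{i=1}^{n-1}[q_i,q_{i+1}]$ has a stable equilibrium with respect to $o$ on the segment $[q_i,q_{i+1}]$ if and only if $\langle q_i,q_{i+1}-q_i\rangle<0<\langle q_{i+1},q_{i+1}-q_i\rangle$; the number of stable equilibria is the number of such segments. *)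

theory Defs
  imports "HOL-Analysis.Analysis" "HOL-Probability.Probability"
begin

text \<open>
  The plane is \<^typ>\<open>real \<times> real\<close> with its Euclidean inner product; the reference point is the
  origin. All derivatives of a curve are taken within its parameter interval, so they are
  one-sided at the endpoints and do not depend on the values of the function outside.
\<close>

primrec C_class_on :: "nat \<Rightarrow> real set \<Rightarrow> (real \<Rightarrow> 'a::real_normed_vector) \<Rightarrow> bool" where
  "C_class_on 0 S f \<longleftrightarrow> continuous_on S f"
| "C_class_on (Suc k) S f \<longleftrightarrow>
     (\<exists>f'. (\<forall>t\<in>S. (f has_vector_derivative f' t) (at t within S)) \<and> C_class_on k S f')"

definition velocity :: "(real \<Rightarrow> real \<times> real) \<Rightarrow> real set \<Rightarrow> real \<Rightarrow> real \<times> real" where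
  "velocity r S t = vector_derivative r (at t within S)"

definition acceleration :: "(real \<Rightarrow> real \<times> real) \<Rightarrow> real set \<Rightarrow> real \<Rightarrow> real \<times> real" where
  "acceleration r S t = vector_derivative (velocity r S) (at t within S)"

text \<open>
  Signed curvature of a parametrised plane curve, positive for left turns. For a curve traversed
  with increasing abscissa this is the curvature \<open>f'' / (1 + f'\<^sup>2) powr (3/2)\<close> of the graph
  \<open>y = f x\<close>, hence \<open>f''\<close> at a point with horizontal tangent.
\<close>

definition signed_curvature :: "(real \<Rightarrow> real \<times> real) \<Rightarrow> real set \<Rightarrow> real \<Rightarrow> real" where
  "signed_curvature r S t =
     (fst (velocity r S t) * snd (acceleration r S t)
      - snd (velocity r S t) * fst (acceleration r S t)) / norm (velocity r S t) ^ 3"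

definition equilibrium_points :: "(real \<Rightarrow> real \<times> real) \<Rightarrow> real set \<Rightarrow> (real \<times> real) set" where
  "equilibrium_points r S = {r t |t. t \<in> S \<and> r t \<bullet> velocity r S t = 0}"

text \<open>A polygonal curve is given by the list of its consecutive vertices.\<close>

definition stable_on_segment :: "real \<times> real \<Rightarrow> real \<times> real \<Rightarrow> bool" where
  "stable_on_segment p q \<longleftrightarrow> p \<bullet> (q - p) < 0 \<and> 0 < q \<bullet> (q - p)"

definition num_stable :: "(real \<times> real) list \<Rightarrow> nat" where
  "num_stable qs = card {i. Suc i < length qs \<and> stable_on_segment (qs ! i) (qs ! Suc i)}"

text \<open>
  The sample space is restricted to parameters in \<open>[-\<delta>, \<delta>]\<close>: outside the parameter interval the
  function \<open>r\<close> is arbitrary and need not be measurable.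
\<close>

definition uniform_params :: "nat \<Rightarrow> real \<Rightarrow> (nat \<Rightarrow> real) measure" where
  "uniform_params n \<delta> =
     PiM {..<n} (\<lambda>_. uniform_measure (restrict_space lborel {-\<delta>..\<delta>}) {-\<delta>..\<delta>})"

definition random_polygon :: "(real \<Rightarrow> real \<times> real) \<Rightarrow> nat \<Rightarrow> (nat \<Rightarrow> real) \<Rightarrow> (real \<times> real) list" where
  "random_polygon r n \<omega> = map r (sort (map \<omega> [0..<n]))"

definition zeta :: "(real \<Rightarrow> real \<times> real) \<Rightarrow> nat \<Rightarrow> real \<Rightarrow> nat measure" where
  "zeta r n \<delta> =
     distr (uniform_params n \<delta>) (count_space UNIV) (\<lambda>\<omega>. num_stable (random_polygon r n \<omega>))"

text \<open>
  Well-definedness: the number of stable equilibria is measurable, so \<open>zeta\<close> is a genuine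
  probability distribution.
\<close>

lemma prob_space_uniform_params:
  assumes "\<delta> > 0"
  shows "prob_space (uniform_params n \<delta>)"
proof -
  have e: "emeasure (restrict_space lborel {-\<delta>..\<delta>}) {-\<delta>..\<delta>} = ennreal (2*\<delta>)"
    using assms by (subst emeasure_restrict_space) auto
  have "prob_space (uniform_measure (restrict_space lborel {-\<delta>..\<delta>}) {-\<delta>..\<delta>})"
    using assms by (intro prob_space_uniform_measure) (auto simp: e)
  then show ?thesis
    unfolding uniform_params_def by (intro prob_space_PiM)
qed

lemma num_stable_sum:
  "num_stable qs =
     (\<Sum>i<length qs - 1. if stable_on_segment (qs ! i) (qs ! Suc i) then 1 else 0)"
proof -
  have "{i. Suc i < length qs \<and> stable_on_segment (qs ! i) (qs ! Suc i)} =
        {i \<in> {..<length qs - 1}. stable_on_segment (qs ! i) (qs ! Suc i)}"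
    by auto
  then show ?thesis
    unfolding num_stable_def card_eq_sum by (simp only: sum.inter_filter finite_lessThan)
qed

lemma measurable_num_stable:
  assumes cont: "continuous_on {-\<delta>..\<delta>} r"
  shows "(\<lambda>\<omega>. num_stable (random_polygon r n \<omega>))
           \<in> measurable (uniform_params n \<delta>) (count_space UNIV)"
proof -
  let ?M = "uniform_params n \<delta>"
  let ?P = "{p. distinct p \<and> set p = {..<n}}"
  have fin: "finite ?P"
    by (rule finite_subset[OF _ finite_subset_distinct[of "{..<n}"]]) auto
  have lenP: "length p = n" if "p \<in> ?P" for p
    using that distinct_card[of p] by auto
  have comp: "(\<lambda>\<omega>. \<omega> j) \<in> measurable ?M (restrict_space borel {-\<delta>..\<delta>})" if "j < n" for j
  proof -
    have "(\<lambda>\<omega>. \<omega> j) \<in> measurable ?M (uniform_measure (restrict_space lborel {-\<delta>..\<delta>}) {-\<delta>..\<delta>})"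
      unfolding uniform_params_def using that by (intro measurable_component_singleton) auto
    moreover have "sets (uniform_measure (restrict_space lborel {-\<delta>..\<delta>}) {-\<delta>..\<delta>})
        = sets (restrict_space borel {-\<delta>..\<delta>})"
      by (simp add: sets_restrict_space)
    ultimately show ?thesis
      by (simp cong: measurable_cong_sets)
  qed
  have c1: "(\<lambda>\<omega>. \<omega> j) \<in> borel_measurable ?M" if "j < n" for j
    using measurable_comp[OF comp[OF that] measurable_restrict_space1[OF measurable_ident]]
    by (simp add: comp_def)
  have c2: "(\<lambda>\<omega>. r (\<omega> j)) \<in> borel_measurable ?M" if "j < n" for j
    using measurable_comp[OF comp[OF that] borel_measurable_continuous_on_restrict[OF cont]]
    by (simp add: comp_def)
  have inP: "p ! i < n" if "p \<in> ?P" "i < n" for p i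
    using that lenP[OF that(1)] nth_mem[of i p] by auto
  have "{\<omega> \<in> space ?M. num_stable (random_polygon r n \<omega>) = k} \<in> sets ?M" for k
  proof -
    have eq: "{\<omega> \<in> space ?M. num_stable (random_polygon r n \<omega>) = k} =
      (\<Union>p\<in>?P. {\<omega> \<in> space ?M. (\<forall>i<n. \<forall>j<n. i \<le> j \<longrightarrow> \<omega> (p ! i) \<le> \<omega> (p ! j)) \<and>
         (\<Sum>i<n-1. if stable_on_segment (r (\<omega> (p ! i))) (r (\<omega> (p ! Suc i))) then 1 else 0) = k})"
      (is "_ = (\<Union>p\<in>_. ?A p)")
    proof -
      have *: "\<omega> \<in> ?A p \<longleftrightarrow> \<omega> \<in> space ?M \<and> sorted (map \<omega> p) \<and> num_stable (map r (map \<omega> p)) = k"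
        if "p \<in> ?P" for p \<omega>
      proof -
        have "sorted (map \<omega> p) \<longleftrightarrow> (\<forall>i<n. \<forall>j<n. i \<le> j \<longrightarrow> \<omega> (p ! i) \<le> \<omega> (p ! j))"
          using lenP[OF that] by (auto simp: sorted_iff_nth_mono)
        moreover have "num_stable (map r (map \<omega> p)) =
          (\<Sum>i<n-1. if stable_on_segment (r (\<omega> (p ! i))) (r (\<omega> (p ! Suc i))) then 1 else 0)"
          unfolding num_stable_sum using lenP[OF that] by (intro sum.cong) auto
        ultimately show ?thesis by simp
      qed
      have srt: "sort (map \<omega> [0..<n]) = map \<omega> p" if "p \<in> ?P" "sorted (map \<omega> p)" for p and \<omega> :: "nat \<Rightarrow> real"
      proof -
        have "mset p = mset [0..<n]"
          by (rule iffD1[OF set_eq_iff_mset_eq_distinct]) (use that(1) in \<open>simp_all add: atLeast0LessThan\<close>)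
        then have "mset (map \<omega> p) = mset (map \<omega> [0..<n])"
          by (simp only: mset_map)
        then show ?thesis
          by (rule properties_for_sort[OF _ that(2)])
      qed
      have ex: "sort_key \<omega> [0..<n] \<in> ?P" "sorted (map \<omega> (sort_key \<omega> [0..<n]))" for \<omega> :: "nat \<Rightarrow> real"
        by (simp_all add: atLeast0LessThan)
      show ?thesis
      proof (intro set_eqI iffI)
        fix \<omega> assume "\<omega> \<in> {\<omega> \<in> space ?M. num_stable (random_polygon r n \<omega>) = k}"
        then have "\<omega> \<in> ?A (sort_key \<omega> [0..<n])"
          unfolding *[OF ex(1)] using ex(2) srt[OF ex] by (simp add: random_polygon_def)
        then show "\<omega> \<in> (\<Union>p\<in>?P. ?A p)"
          using ex(1) by blast
      next
        fix \<omega> assume "\<omega> \<in> (\<Union>p\<in>?P. ?A p)"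
        then obtain p where p: "p \<in> ?P" "\<omega> \<in> ?A p" by blast
        then show "\<omega> \<in> {\<omega> \<in> space ?M. num_stable (random_polygon r n \<omega>) = k}"
          using srt[OF p(1)] unfolding *[OF p(1)] by (simp add: random_polygon_def)
      qed
    qed
    have "?A p \<in> sets ?M" if p: "p \<in> ?P" for p
    proof -
      have [measurable]: "Measurable.pred ?M (\<lambda>\<omega>. \<omega> (p ! i) \<le> \<omega> (p ! j))" if "i < n" "j < n" for i j
        unfolding pred_def by (intro borel_measurable_le c1 inP p that)
      have [measurable]: "Measurable.pred ?M
          (\<lambda>\<omega>. stable_on_segment (r (\<omega> (p ! i))) (r (\<omega> (p ! Suc i))))" if "i < n - 1" for i
      proof -
        have [measurable]: "(\<lambda>\<omega>. r (\<omega> (p ! i))) \<in> borel_measurable ?M"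
            "(\<lambda>\<omega>. r (\<omega> (p ! Suc i))) \<in> borel_measurable ?M"
          using that by (auto intro!: c2 inP p)
        show ?thesis
          unfolding stable_on_segment_def by measurable
      qed
      have "Measurable.pred ?M (\<lambda>\<omega>. \<forall>i\<in>{..<n}. \<forall>j\<in>{..<n}. i \<le> j \<longrightarrow> \<omega> (p ! i) \<le> \<omega> (p ! j))"
        by (intro pred_intros_finite) auto
      moreover have "(\<lambda>\<omega>. \<Sum>i<n-1. if stable_on_segment (r (\<omega> (p ! i))) (r (\<omega> (p ! Suc i)))
          then 1 else 0 :: nat) \<in> measurable ?M (count_space UNIV)"
        by measurable
      ultimately have "Measurable.pred ?M (\<lambda>\<omega>. (\<forall>i\<in>{..<n}. \<forall>j\<in>{..<n}. i \<le> j \<longrightarrow> \<omega> (p ! i) \<le> \<omega> (p ! j)) \<and>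
         (\<Sum>i<n-1. if stable_on_segment (r (\<omega> (p ! i))) (r (\<omega> (p ! Suc i))) then 1 else 0) = k)"
        by measurable
      then show ?thesis
        by (simp add: pred_def Ball_def)
    qed
    then show ?thesis
      unfolding eq by (rule sets.finite_UN[OF fin])
  qed
  then have "(\<lambda>\<omega>. num_stable (random_polygon r n \<omega>)) -` {k} \<inter> space ?M \<in> sets ?M" for k
    by (simp only: vimage_def Int_def mem_Collect_eq singleton_iff conj_commute)
  then show ?thesis
    by (simp add: measurable_count_space_eq2_countable)
qed

lemma prob_space_zeta:
  assumes "\<delta> > 0" and "continuous_on {-\<delta>..\<delta>} r"
  shows "prob_space (zeta r n \<delta>)"
  unfolding zeta_def
  by (intro prob_space.prob_space_distr prob_space_uniform_params measurable_num_stable assms)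

end

theory Submission
  imports Defs
begin

text \<open>
  A polygon side joining \<open>r s\<close> and \<open>r t\<close> with \<open>s < t\<close> both close to \<open>0\<close> sees the curve only through
  its expansion \<open>(v t, \<rho> + \<kappa> v\<^sup>2 t\<^sup>2 / 2)\<close> at the equilibrium. To second order the two inner products
  that decide stability are positive multiples of \<open>L (s + t) \<mp> (t - s)\<close> with \<open>L = 1 + \<kappa> \<rho>\<close>. So after
  rescaling the parameters to \<open>[-1, 1]\<close> the side is stable, in the limit and off the null set where
  equality holds, exactly when \<open>\<bar>L\<bar> * \<bar>s + t\<bar> < t - s\<close> (\<open>stable_on_small_segment\<close>). The
  condition involves \<open>L\<close> through \<open>lam = \<bar>L\<bar>\<close>, because a change of sign of \<open>L\<close> interchanges the two
  inequalities.

  The number of stable sides is the number of ordered pairs of sample points that span a stable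
  side and have no further sample point between them. By linearity and Fubini its expectation is
  \<open>n (n - 1)\<close> times a double integral over the two end points, in which the other \<open>n - 2\<close> points
  contribute the factor \<open>(1 - (t - s) / 2) ^ (n - 2)\<close> (\<open>expected_num_stable\<close>). Dominated
  convergence replaces stability by the limiting condition (\<open>tendsto_pair_integral\<close>). In the
  coordinates \<open>e = (t - s) / 2\<close> and \<open>(s + t) / 2\<close>, for fixed \<open>e\<close> the midpoint ranges over an interval of length
  \<open>2 * min (e / lam) (1 - e)\<close>, which leaves
  \<open>n (n - 1) \<integral> (1 - e) ^ (n - 2) * min (e / lam) (1 - e) de\<close> over \<open>[0, 1]\<close>. Splitting this at
  \<open>e = lam / (1 + lam)\<close>, where the two terms of the minimum agree, gives the claimed value
  (\<open>gap_weight_integral\<close>).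
\<close>

section \<open>Independent uniform parameters\<close>

text \<open>
  The ground space is the interval itself and not \<open>\<real>\<close>, so that sample points never
  leave the interval; rescaling by \<open>\<delta>\<close> turns every expectation into a Lebesgue integral over the
  fixed interval \<open>[-1, 1]\<close>, on which limits \<open>\<delta> \<rightarrow> 0\<close> can be taken.
\<close>

abbreviation uniform_interval :: "real \<Rightarrow> real measure" where
  "uniform_interval \<delta> \<equiv> uniform_measure (restrict_space lborel {-\<delta>..\<delta>}) {-\<delta>..\<delta>}"

lemma measurable_ident_uniform_interval [measurable]:
  "(\<lambda>x. x) \<in> measurable (uniform_interval \<delta>) borel"
proof -
  have "(\<lambda>x. x) \<in> measurable (restrict_space lborel {-\<delta>..\<delta>}) borel"
    by (rule measurable_restrict_space1) simp
  then show ?thesis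
    by (simp cong: measurable_cong_sets)
qed

lemma prob_space_uniform_interval:
  assumes "\<delta> > 0"
  shows "prob_space (uniform_interval \<delta>)"
  using assms by (intro prob_space_uniform_measure) (auto simp: emeasure_restrict_space)

lemma nn_integral_uniform_interval:
  fixes f :: "real \<Rightarrow> ennreal"
  assumes \<delta>: "\<delta> > 0" and [measurable]: "f \<in> borel_measurable borel"
  shows "(\<integral>\<^sup>+x. f x \<partial>uniform_interval \<delta>)
       = ennreal (1/2) * (\<integral>\<^sup>+x. f (\<delta> * x) * indicator {-1..1} x \<partial>lborel)"
proof -
  let ?R = "restrict_space lborel {-\<delta>..\<delta>}"
  have [measurable]: "f \<in> borel_measurable ?R"
    by (rule measurable_restrict_space1) simp
  have S: "{-\<delta>..\<delta>} \<in> sets ?R"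
    by (simp add: sets_restrict_space_iff)
  have e: "emeasure ?R {-\<delta>..\<delta>} = ennreal (2*\<delta>)"
    using \<delta> by (subst emeasure_restrict_space) auto
  have "(\<integral>\<^sup>+x. f x \<partial>uniform_interval \<delta>)
      = (\<integral>\<^sup>+x. f x * indicator {-\<delta>..\<delta>} x \<partial>?R) / ennreal (2*\<delta>)"
    by (subst nn_integral_uniform_measure) (use S e in auto)
  also have "(\<integral>\<^sup>+x. f x * indicator {-\<delta>..\<delta>} x \<partial>?R) = (\<integral>\<^sup>+x. f x * indicator {-\<delta>..\<delta>} x \<partial>lborel)"
    by (subst nn_integral_restrict_space)
       (auto intro!: nn_integral_cong simp: indicator_def)
  also have "\<dots> = ennreal \<delta> * (\<integral>\<^sup>+x. f (\<delta> * x) * indicator {-\<delta>..\<delta>} (\<delta> * x) \<partial>lborel)"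
    using \<delta> by (subst nn_integral_real_affine[where c=\<delta> and t=0]) auto
  also have "(\<integral>\<^sup>+x. f (\<delta> * x) * indicator {-\<delta>..\<delta>} (\<delta> * x) \<partial>lborel)
      = (\<integral>\<^sup>+x. f (\<delta> * x) * indicator {-1..1} x \<partial>lborel)"
  proof (intro nn_integral_cong)
    fix x :: real
    have "-\<delta> \<le> \<delta> * x \<longleftrightarrow> -1 \<le> x" "\<delta> * x \<le> \<delta> \<longleftrightarrow> x \<le> 1"
      using \<delta> mult_le_cancel_left_pos[of \<delta> "-1" x] by auto
    then show "f (\<delta> * x) * indicator {-\<delta>..\<delta>} (\<delta> * x) = f (\<delta> * x) * indicator {-1..1} x"
      by (simp add: indicator_def)
  qed
  also have "ennreal \<delta> * X / ennreal (2*\<delta>) = ennreal (1/2) * X" for X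
  proof -
    have "ennreal \<delta> * X / ennreal (2*\<delta>) = (ennreal \<delta> * inverse (ennreal (2*\<delta>))) * X"
      by (simp add: divide_ennreal_def mult_ac)
    also have "ennreal \<delta> * inverse (ennreal (2*\<delta>)) = ennreal (1/2)"
      using \<delta> by (simp add: inverse_ennreal flip: ennreal_mult)
    finally show ?thesis .
  qed
  finally show ?thesis .
qed

text \<open>
  Two coordinates are singled out and the others enter only through a product, one factor for each.
  Once the two coordinates are fixed, the remaining ones are independent copies of the same
  experiment, which produces the power. With \<open>F\<close> the indicator of a stable pair and \<open>G\<close> the
  indicator of avoiding the gap this gives the probability that a given pair is consecutive
  and stable; with \<open>F\<close> the indicator of the diagonal it shows that ties are negligible.
\<close>

lemma nn_integral_PiM_two_coordinates:
  fixes F :: "'a \<Rightarrow> 'a \<Rightarrow> ennreal" and G :: "'a \<Rightarrow> 'a \<Rightarrow> 'a \<Rightarrow> ennreal"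
  assumes "prob_space M" and fin: "finite I" and ij: "i \<in> I" "j \<in> I" "i \<noteq> j"
    and F: "(\<lambda>(s, t). F s t) \<in> borel_measurable (M \<Otimes>\<^sub>M M)"
    and G: "(\<lambda>(s, t, x). G s t x) \<in> borel_measurable (M \<Otimes>\<^sub>M (M \<Otimes>\<^sub>M M))"
  shows "(\<integral>\<^sup>+\<omega>. F (\<omega> i) (\<omega> j) * (\<Prod>k\<in>I - {i, j}. G (\<omega> i) (\<omega> j) (\<omega> k)) \<partial>PiM I (\<lambda>_. M))
       = (\<integral>\<^sup>+s. \<integral>\<^sup>+t. F s t * (\<integral>\<^sup>+x. G s t x \<partial>M) ^ (card I - 2) \<partial>M \<partial>M)"
proof -
  interpret prob_space M by fact
  interpret product_prob_space "\<lambda>_. M" I by unfold_locales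
  let ?K = "I - {i, j}"
  have I: "I = insert i (insert j ?K)" using ij by auto
  have m1: "(\<lambda>\<omega>. \<omega> k) \<in> measurable (PiM I (\<lambda>_. M)) M" if "k \<in> I" for k
    using that by simp
  have mF: "(\<lambda>\<omega>. F (\<omega> i) (\<omega> j)) \<in> borel_measurable (PiM I (\<lambda>_. M))"
    using measurable_compose[OF measurable_Pair[OF m1[OF ij(1)] m1[OF ij(2)]] F] by simp
  have mG: "(\<lambda>\<omega>. G (\<omega> i) (\<omega> j) (\<omega> k)) \<in> borel_measurable (PiM I (\<lambda>_. M))" if "k \<in> I" for k
    using measurable_compose[OF measurable_Pair[OF m1[OF ij(1)] measurable_Pair[OF m1[OF ij(2)] m1[OF that]]] G]
    by simp
  have mf: "(\<lambda>\<omega>. F (\<omega> i) (\<omega> j) * (\<Prod>k\<in>?K. G (\<omega> i) (\<omega> j) (\<omega> k))) \<in> borel_measurable (PiM I (\<lambda>_. M))"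
    by (intro borel_measurable_times_ennreal mF borel_measurable_prod_ennreal mG) auto
  have "(\<integral>\<^sup>+\<omega>. F (\<omega> i) (\<omega> j) * (\<Prod>k\<in>?K. G (\<omega> i) (\<omega> j) (\<omega> k)) \<partial>PiM I (\<lambda>_. M))
     = (\<integral>\<^sup>+s. \<integral>\<^sup>+\<omega>. F s (\<omega> j) * (\<Prod>k\<in>?K. G s (\<omega> j) (\<omega> k)) \<partial>PiM (insert j ?K) (\<lambda>_. M) \<partial>M)"
    by (subst I, subst product_nn_integral_insert_rev)
       (use fin ij mf I in \<open>auto intro!: nn_integral_cong prod.cong arg_cong2[where f="(*)"]\<close>)
  also have "\<dots> = (\<integral>\<^sup>+s. \<integral>\<^sup>+t. F s t * (\<integral>\<^sup>+x. G s t x \<partial>M) ^ (card I - 2) \<partial>M \<partial>M)"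
  proof (intro nn_integral_cong)
    fix s assume s: "s \<in> space M"
    have m2: "(\<lambda>\<omega>. \<omega> k) \<in> measurable (PiM (insert j ?K) (\<lambda>_. M)) M" if "k \<in> insert j ?K" for k
      using that by simp
    have mF: "(\<lambda>\<omega>. F s (\<omega> j)) \<in> borel_measurable (PiM (insert j ?K) (\<lambda>_. M))"
      using measurable_compose[OF measurable_Pair[OF measurable_const[OF s] m2[of j]] F] by simp
    have mG: "(\<lambda>\<omega>. G s (\<omega> j) (\<omega> k)) \<in> borel_measurable (PiM (insert j ?K) (\<lambda>_. M))" if "k \<in> ?K" for k
      using measurable_compose[OF measurable_Pair[OF measurable_const[OF s] measurable_Pair[OF m2[of j] m2[of k]]] G] that
      by simp
    have mf: "(\<lambda>\<omega>. F s (\<omega> j) * (\<Prod>k\<in>?K. G s (\<omega> j) (\<omega> k))) \<in> borel_measurable (PiM (insert j ?K) (\<lambda>_. M))"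
      by (intro borel_measurable_times_ennreal mF borel_measurable_prod_ennreal mG) auto
    have "(\<integral>\<^sup>+\<omega>. F s (\<omega> j) * (\<Prod>k\<in>?K. G s (\<omega> j) (\<omega> k)) \<partial>PiM (insert j ?K) (\<lambda>_. M))
      = (\<integral>\<^sup>+t. \<integral>\<^sup>+\<omega>. F s t * (\<Prod>k\<in>?K. G s t (\<omega> k)) \<partial>PiM ?K (\<lambda>_. M) \<partial>M)"
      by (subst product_nn_integral_insert_rev)
       (use fin ij mf in \<open>auto intro!: nn_integral_cong prod.cong arg_cong2[where f="(*)"]\<close>)
    also have "\<dots> = (\<integral>\<^sup>+t. F s t * (\<integral>\<^sup>+x. G s t x \<partial>M) ^ (card I - 2) \<partial>M)"
    proof (intro nn_integral_cong)
      fix t assume t: "t \<in> space M"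
      have Gst: "G s t \<in> borel_measurable M"
        using measurable_compose[OF measurable_Pair[OF measurable_const[OF s] measurable_Pair[OF measurable_const[OF t] measurable_ident_sets[OF refl]]] G]
        by simp
      have mG: "(\<lambda>\<omega>. \<Prod>k\<in>?K. G s t (\<omega> k)) \<in> borel_measurable (PiM ?K (\<lambda>_. M))"
        by (intro borel_measurable_prod_ennreal measurable_compose[OF _ Gst]) simp
      have "(\<integral>\<^sup>+\<omega>. F s t * (\<Prod>k\<in>?K. G s t (\<omega> k)) \<partial>PiM ?K (\<lambda>_. M))
          = F s t * (\<integral>\<^sup>+\<omega>. (\<Prod>k\<in>?K. G s t (\<omega> k)) \<partial>PiM ?K (\<lambda>_. M))"
        by (rule nn_integral_cmult[OF mG])
      also have "(\<integral>\<^sup>+\<omega>. (\<Prod>k\<in>?K. G s t (\<omega> k)) \<partial>PiM ?K (\<lambda>_. M)) = (\<Prod>k\<in>?K. \<integral>\<^sup>+x. G s t x \<partial>M)"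
        by (rule product_nn_integral_prod) (use fin Gst in auto)
      also have "\<dots> = (\<integral>\<^sup>+x. G s t x \<partial>M) ^ (card I - 2)"
        using ij fin by (simp add: card_Diff_subset numeral_2_eq_2)
      finally show "(\<integral>\<^sup>+\<omega>. F s t * (\<Prod>k\<in>?K. G s t (\<omega> k)) \<partial>PiM ?K (\<lambda>_. M))
          = F s t * (\<integral>\<^sup>+x. G s t x \<partial>M) ^ (card I - 2)" .
    qed
    finally show "(\<integral>\<^sup>+\<omega>. F s (\<omega> j) * (\<Prod>k\<in>?K. G s (\<omega> j) (\<omega> k)) \<partial>PiM (insert j ?K) (\<lambda>_. M))
       = (\<integral>\<^sup>+t. F s t * (\<integral>\<^sup>+x. G s t x \<partial>M) ^ (card I - 2) \<partial>M)" .
  qed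
  finally show ?thesis .
qed

section \<open>Sides of the polygon as consecutive pairs\<close>

text \<open>
  Neighbours in a strictly sorted list can be described without the order of the list: nothing
  lies between them. This frees the count of polygon sides from the sorting step.
\<close>

lemma card_consecutive_sorted:
  fixes xs :: "'a::linorder list"
  assumes "sorted xs" "distinct xs"
  shows "card {i. Suc i < length xs \<and> P (xs ! i) (xs ! Suc i)}
       = card {(u, v). u \<in> set xs \<and> v \<in> set xs \<and> u < v \<and> P u v \<and> (\<forall>w\<in>set xs. \<not> (u < w \<and> w < v))}"
proof (rule bij_betw_same_card)
  have less: "xs ! i < xs ! j \<longleftrightarrow> i < j" if "i < length xs" "j < length xs" for i j
    using that assms by (metis linorder_neqE_nat not_less_iff_gr_or_eq sorted_wrt_nth_less strict_sorted_iff)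
  show "bij_betw (\<lambda>i. (xs ! i, xs ! Suc i)) {i. Suc i < length xs \<and> P (xs ! i) (xs ! Suc i)}
    {(u, v). u \<in> set xs \<and> v \<in> set xs \<and> u < v \<and> P u v \<and> (\<forall>w\<in>set xs. \<not> (u < w \<and> w < v))}"
    unfolding bij_betw_def
  proof (intro conjI set_eqI iffI)
    show "inj_on (\<lambda>i. (xs ! i, xs ! Suc i)) {i. Suc i < length xs \<and> P (xs ! i) (xs ! Suc i)}"
      using assms by (auto simp: inj_on_def nth_eq_iff_index_eq)
  next
    fix p
    assume "p \<in> (\<lambda>i. (xs ! i, xs ! Suc i)) ` {i. Suc i < length xs \<and> P (xs ! i) (xs ! Suc i)}"
    then show "p \<in> {(u, v). u \<in> set xs \<and> v \<in> set xs \<and> u < v \<and> P u v \<and> (\<forall>w\<in>set xs. \<not> (u < w \<and> w < v))}"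
      by (auto simp: less) (auto simp: in_set_conv_nth less)
  next
    fix p
    assume "p \<in> {(u, v). u \<in> set xs \<and> v \<in> set xs \<and> u < v \<and> P u v \<and> (\<forall>w\<in>set xs. \<not> (u < w \<and> w < v))}"
    then obtain i j where p: "p = (xs ! i, xs ! j)" "i < length xs" "j < length xs" "i < j" "P (xs ! i) (xs ! j)"
      and gap: "\<forall>w\<in>set xs. \<not> (xs ! i < w \<and> w < xs ! j)"
      by (auto simp: in_set_conv_nth less)
    \<comment> \<open>Otherwise the entry right after the first one would lie in the gap.\<close>
    have "\<not> (xs ! i < xs ! Suc i \<and> xs ! Suc i < xs ! j)"
      using gap p by simp
    then have "j = Suc i"
      using p less[of i "Suc i"] less[of "Suc i" j] by auto
    then show "p \<in> (\<lambda>i. (xs ! i, xs ! Suc i)) ` {i. Suc i < length xs \<and> P (xs ! i) (xs ! Suc i)}"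
      using p by auto
  qed
qed

text \<open>
  Ties must be excluded: if \<open>\<omega> i = \<omega> k\<close>, a side starting at this parameter would be
  counted once for \<open>i\<close> and once for \<open>k\<close>.
\<close>

lemma num_stable_random_polygon:
  assumes inj: "inj_on \<omega> {..<n}"
  shows "num_stable (random_polygon r n \<omega>)
       = card {(i, j). i < n \<and> j < n \<and> \<omega> i < \<omega> j \<and> stable_on_segment (r (\<omega> i)) (r (\<omega> j))
            \<and> (\<forall>k<n. \<not> (\<omega> i < \<omega> k \<and> \<omega> k < \<omega> j))}" (is "_ = card ?C")
proof -
  define xs where "xs = sort (map \<omega> [0..<n])"
  have xs: "sorted xs" "distinct xs" "set xs = \<omega> ` {..<n}"
    using inj by (auto simp: xs_def distinct_map atLeast0LessThan)
  let ?D = "{(u, v). u \<in> set xs \<and> v \<in> set xs \<and> u < v \<and> stable_on_segment (r u) (r v)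
              \<and> (\<forall>w\<in>set xs. \<not> (u < w \<and> w < v))}"
  have "num_stable (random_polygon r n \<omega>)
      = card {i. Suc i < length xs \<and> stable_on_segment (r (xs ! i)) (r (xs ! Suc i))}"
    unfolding num_stable_def random_polygon_def xs_def[symmetric]
    by (intro arg_cong[where f=card]) auto
  also have "\<dots> = card ?D"
    by (rule card_consecutive_sorted[OF xs(1,2), where P="\<lambda>u v. stable_on_segment (r u) (r v)"])
  also have "?D = map_prod \<omega> \<omega> ` ?C"
    unfolding xs(3) by force
  also have "card \<dots> = card ?C"
    by (rule card_image) (use inj in \<open>auto simp: inj_on_def\<close>)
  finally show ?thesis .
qed

section \<open>Expected number of stable sides\<close>

text \<open>
  For \<open>s < t\<close> in \<open>[-1, 1]\<close>, this is the probability that \<open>m\<close> independent uniform points of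
  \<open>[-1, 1]\<close> all avoid the open interval from \<open>s\<close> to \<open>t\<close>; the cut-off restricts the domain of
  integration to such pairs.
\<close>

definition gap_weight :: "nat \<Rightarrow> real \<times> real \<Rightarrow> real" where
  "gap_weight m = (\<lambda>(s, t). if -1 \<le> s \<and> s < t \<and> t \<le> 1 then (1 - (t - s) / 2) ^ m else 0)"

lemma borel_measurable_gap_weight [measurable]: "gap_weight m \<in> borel_measurable (borel \<Otimes>\<^sub>M borel)"
  unfolding gap_weight_def by measurable

lemma gap_weight_bounds: "0 \<le> gap_weight m p" "gap_weight m p \<le> indicator ({-1..1} \<times> {-1..1}) p"
  by (cases p; auto simp: gap_weight_def intro!: power_le_one)+

lemma measure_outside_gap:
  assumes "-1 \<le> s" "s < t" "t \<le> 1" "\<delta> > (0::real)"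
  shows "ennreal (1/2) * (\<integral>\<^sup>+x. (if \<delta> * s < \<delta> * x \<and> \<delta> * x < \<delta> * t then 0 else 1) * indicator {-1..1} x \<partial>lborel)
       = ennreal (1 - (t - s) / 2)"
proof -
  have "(\<integral>\<^sup>+x. (if \<delta> * s < \<delta> * x \<and> \<delta> * x < \<delta> * t then 0 else 1) * indicator {-1..1} x \<partial>lborel)
      = (\<integral>\<^sup>+x. indicator ({-1..s} \<union> {t..1}) x \<partial>lborel)"
    by (intro nn_integral_cong) (use assms in \<open>auto simp: indicator_def\<close>)
  also have "\<dots> = emeasure lborel {-1..s} + emeasure lborel {t..1}"
    by (simp, subst plus_emeasure) (use assms in auto)
  also have "\<dots> = ennreal ((s + 1) + (1 - t))"
    using assms by (subst ennreal_plus) auto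
  finally have "(\<integral>\<^sup>+x. (if \<delta> * s < \<delta> * x \<and> \<delta> * x < \<delta> * t then 0 else 1) * indicator {-1..1} x \<partial>lborel)
      = ennreal ((s + 1) + (1 - t))" .
  moreover have "1/2 * ((s + 1) + (1 - t)) = 1 - (t - s) / 2"
    by (simp add: field_simps)
  ultimately show ?thesis
    using assms by (simp only: ennreal_mult[symmetric])
qed

lemma measurable_uniform_params_component [measurable]:
  "k < n \<Longrightarrow> (\<lambda>\<omega>. \<omega> k) \<in> borel_measurable (uniform_params n \<delta>)"
  unfolding uniform_params_def
  using measurable_compose[OF measurable_component_singleton[of k "{..<n}" "\<lambda>_. uniform_interval \<delta>"]
    measurable_ident_uniform_interval]
  by simp

text \<open>
  Written as a sum of products over indices, the count has the form required by
  \<open>nn_integral_PiM_two_coordinates\<close>.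
\<close>

lemma card_pairs_as_sum:
  fixes \<omega> :: "nat \<Rightarrow> 'a::linorder"
  shows "(of_nat (card {(i, j). i < n \<and> j < n \<and> \<omega> i < \<omega> j \<and> A (\<omega> i) (\<omega> j)
            \<and> (\<forall>k<n. \<not> (\<omega> i < \<omega> k \<and> \<omega> k < \<omega> j))}) :: ennreal)
     = (\<Sum>(i, j)\<in>{(i, j). i < n \<and> j < n \<and> i \<noteq> j}.
          (if \<omega> i < \<omega> j \<and> A (\<omega> i) (\<omega> j) then 1 else 0)
          * (\<Prod>k\<in>{..<n} - {i, j}. if \<omega> i < \<omega> k \<and> \<omega> k < \<omega> j then 0 else 1))"
    (is "of_nat (card ?C) = (\<Sum>(i, j)\<in>?Q. ?f i j)")
proof -
  have fin: "finite ?Q"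
    by (rule finite_subset[of _ "{..<n} \<times> {..<n}"]) auto
  have pair: "?f i j = (if (i, j) \<in> ?C then 1 else 0)" if "(i, j) \<in> ?Q" for i j
  proof -
    have "(\<Prod>k\<in>{..<n} - {i, j}. if \<omega> i < \<omega> k \<and> \<omega> k < \<omega> j then 0 else 1 :: ennreal)
       = (if \<forall>k<n. \<not> (\<omega> i < \<omega> k \<and> \<omega> k < \<omega> j) then 1 else 0)"
    proof (cases "\<forall>k<n. \<not> (\<omega> i < \<omega> k \<and> \<omega> k < \<omega> j)")
      case False
      then obtain k where "k < n" "\<omega> i < \<omega> k" "\<omega> k < \<omega> j" by blast
      then have "k \<in> {..<n} - {i, j}" by auto
      with \<open>\<omega> i < \<omega> k\<close> \<open>\<omega> k < \<omega> j\<close> show ?thesis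
        using False by (auto intro!: prod_zero bexI[of _ k])
    qed (auto intro!: prod.neutral)
    then show ?thesis using that by auto
  qed
  have "(\<Sum>(i, j)\<in>?Q. ?f i j) = (\<Sum>p\<in>?Q. if p \<in> ?C then 1 else 0)"
  proof (rule sum.cong[OF refl])
    fix p assume "p \<in> ?Q"
    then show "(case p of (i, j) \<Rightarrow> ?f i j) = (if p \<in> ?C then 1 else 0)"
      using pair[of "fst p" "snd p"] by (simp only: prod.collapse case_prod_beta)
  qed
  also have "\<dots> = of_nat (card (?Q \<inter> ?C))"
    using fin by (simp add: sum.If_cases)
  also have "?Q \<inter> ?C = ?C" by auto
  finally show ?thesis by simp
qed

text \<open>
  The constant \<open>1/4\<close> is the density of two independent uniform points of \<open>[-1, 1]\<close>.
\<close>

lemma expected_pair_consecutive: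
  assumes \<delta>: "\<delta> > 0" and ij: "i < n" "j < n" "i \<noteq> j"
    and A [measurable]: "Measurable.pred (borel \<Otimes>\<^sub>M borel) (\<lambda>(s, t). A s t)"
  shows "(\<integral>\<^sup>+\<omega>. (if \<omega> i < \<omega> j \<and> A (\<omega> i) (\<omega> j) then 1 else 0)
           * (\<Prod>k\<in>{..<n} - {i, j}. if \<omega> i < \<omega> k \<and> \<omega> k < \<omega> j then 0 else 1) \<partial>uniform_params n \<delta>)
       = ennreal (1/4) * (\<integral>\<^sup>+p. (if A (\<delta> * fst p) (\<delta> * snd p) then ennreal (gap_weight (n - 2) p) else 0)
            \<partial>(lborel \<Otimes>\<^sub>M lborel))"
proof -
  define U where "U = uniform_interval \<delta>"
  define F where "F s t = (if s < t \<and> A s t then 1 else 0 :: ennreal)" for s t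
  define G where "G s t x = (if s < x \<and> x < t then 0 else 1 :: ennreal)" for s t x :: real
  define g where "g s t = ennreal (1/2) * (\<integral>\<^sup>+x. G s t (\<delta> * x) * indicator {-1..1} x \<partial>lborel)" for s t
  have U: "prob_space U"
    unfolding U_def by (rule prob_space_uniform_interval[OF \<delta>])
  have [measurable]: "(\<lambda>x. x) \<in> measurable U borel"
    unfolding U_def by measurable
  have [measurable]: "(\<lambda>(s, t). F s t) \<in> borel_measurable (borel \<Otimes>\<^sub>M borel)"
    unfolding F_def by measurable
  have [measurable]: "(\<lambda>(s, t, x). G s t x) \<in> borel_measurable (borel \<Otimes>\<^sub>M (borel \<Otimes>\<^sub>M borel))"
    unfolding G_def by measurable
  have [measurable]: "(\<lambda>(s, t). g s t) \<in> borel_measurable (borel \<Otimes>\<^sub>M borel)"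
    unfolding g_def G_def by measurable
  have gU: "(\<integral>\<^sup>+x. G s t x \<partial>U) = g s t" for s t
    unfolding U_def g_def by (rule nn_integral_uniform_interval[OF \<delta>]) measurable
  have "(\<integral>\<^sup>+\<omega>. F (\<omega> i) (\<omega> j) * (\<Prod>k\<in>{..<n} - {i, j}. G (\<omega> i) (\<omega> j) (\<omega> k)) \<partial>PiM {..<n} (\<lambda>_. U))
      = (\<integral>\<^sup>+s. \<integral>\<^sup>+t. F s t * (\<integral>\<^sup>+x. G s t x \<partial>U) ^ (card {..<n} - 2) \<partial>U \<partial>U)"
  proof (rule nn_integral_PiM_two_coordinates[OF U])
    have "(\<lambda>p. F (fst p) (snd p)) \<in> borel_measurable (U \<Otimes>\<^sub>M U)"
      by measurable
    then show "(\<lambda>(s, t). F s t) \<in> borel_measurable (U \<Otimes>\<^sub>M U)"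
      by (simp add: case_prod_beta')
    have "(\<lambda>p. G (fst p) (fst (snd p)) (snd (snd p))) \<in> borel_measurable (U \<Otimes>\<^sub>M (U \<Otimes>\<^sub>M U))"
      unfolding G_def by measurable
    then show "(\<lambda>(s, t, x). G s t x) \<in> borel_measurable (U \<Otimes>\<^sub>M (U \<Otimes>\<^sub>M U))"
      by (simp add: case_prod_beta')
  qed (use ij in auto)
  also have "\<dots> = (\<integral>\<^sup>+s. ennreal (1/2) * (\<integral>\<^sup>+t. F s (\<delta> * t) * g s (\<delta> * t) ^ (n - 2) * indicator {-1..1} t \<partial>lborel) \<partial>U)"
    unfolding gU card_lessThan unfolding U_def
    by (intro nn_integral_cong nn_integral_uniform_interval[OF \<delta>]) measurable
  also have "\<dots> = ennreal (1/2) * (\<integral>\<^sup>+s. ennreal (1/2) * (\<integral>\<^sup>+t. F (\<delta> * s) (\<delta> * t)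
      * g (\<delta> * s) (\<delta> * t) ^ (n - 2) * indicator {-1..1} t \<partial>lborel) * indicator {-1..1} s \<partial>lborel)"
    unfolding U_def by (rule nn_integral_uniform_interval[OF \<delta>]) measurable
  also have "\<dots> = ennreal (1/4) * (\<integral>\<^sup>+s. \<integral>\<^sup>+t. F (\<delta> * s) (\<delta> * t)
      * g (\<delta> * s) (\<delta> * t) ^ (n - 2) * indicator {-1..1} t * indicator {-1..1} s \<partial>lborel \<partial>lborel)"
  proof -
    have "(\<integral>\<^sup>+s. ennreal (1/2) * (\<integral>\<^sup>+t. F (\<delta> * s) (\<delta> * t)
      * g (\<delta> * s) (\<delta> * t) ^ (n - 2) * indicator {-1..1} t \<partial>lborel) * indicator {-1..1} s \<partial>lborel)
      = (\<integral>\<^sup>+s. ennreal (1/2) * (\<integral>\<^sup>+t. F (\<delta> * s) (\<delta> * t)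
      * g (\<delta> * s) (\<delta> * t) ^ (n - 2) * indicator {-1..1} t * indicator {-1..1} s \<partial>lborel) \<partial>lborel)"
      by (subst nn_integral_multc) (auto simp: mult.assoc)
    also have "\<dots> = ennreal (1/2) * (\<integral>\<^sup>+s. (\<integral>\<^sup>+t. F (\<delta> * s) (\<delta> * t)
      * g (\<delta> * s) (\<delta> * t) ^ (n - 2) * indicator {-1..1} t * indicator {-1..1} s \<partial>lborel) \<partial>lborel)"
      by (rule nn_integral_cmult) measurable
    finally have *: "(\<integral>\<^sup>+s. ennreal (1/2) * (\<integral>\<^sup>+t. F (\<delta> * s) (\<delta> * t)
      * g (\<delta> * s) (\<delta> * t) ^ (n - 2) * indicator {-1..1} t \<partial>lborel) * indicator {-1..1} s \<partial>lborel)
      = ennreal (1/2) * (\<integral>\<^sup>+s. (\<integral>\<^sup>+t. F (\<delta> * s) (\<delta> * t)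
      * g (\<delta> * s) (\<delta> * t) ^ (n - 2) * indicator {-1..1} t * indicator {-1..1} s \<partial>lborel) \<partial>lborel)" .
    have "ennreal (1/4) = ennreal (1/2) * ennreal (1/2)"
      by (subst ennreal_mult[symmetric]) auto
    then show ?thesis
      unfolding * by (simp only: mult.assoc)
  qed
  also have "(\<integral>\<^sup>+s. \<integral>\<^sup>+t. F (\<delta> * s) (\<delta> * t)
      * g (\<delta> * s) (\<delta> * t) ^ (n - 2) * indicator {-1..1} t * indicator {-1..1} s \<partial>lborel \<partial>lborel)
    = (\<integral>\<^sup>+s. \<integral>\<^sup>+t. (if A (\<delta> * s) (\<delta> * t) then ennreal (gap_weight (n - 2) (s, t)) else 0) \<partial>lborel \<partial>lborel)"
  proof (intro nn_integral_cong)
    fix s t :: real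
    show "F (\<delta> * s) (\<delta> * t) * g (\<delta> * s) (\<delta> * t) ^ (n - 2) * indicator {-1..1} t * indicator {-1..1} s
      = (if A (\<delta> * s) (\<delta> * t) then ennreal (gap_weight (n - 2) (s, t)) else 0)"
    proof (cases "-1 \<le> s \<and> s < t \<and> t \<le> 1")
      case True
      then have "g (\<delta> * s) (\<delta> * t) = ennreal (1 - (t - s) / 2)"
        unfolding g_def G_def using measure_outside_gap[of s t \<delta>] \<delta> by simp
      then show ?thesis
        using True \<delta> by (simp add: F_def gap_weight_def ennreal_power)
    qed (use \<delta> in \<open>auto simp: F_def gap_weight_def indicator_def\<close>)
  qed
  also have "\<dots> = (\<integral>\<^sup>+p. (if A (\<delta> * fst p) (\<delta> * snd p) then ennreal (gap_weight (n - 2) p) else 0)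
            \<partial>(lborel \<Otimes>\<^sub>M lborel))"
  proof -
    have "(\<lambda>p. if A (\<delta> * fst p) (\<delta> * snd p) then ennreal (gap_weight (n - 2) p) else 0)
        \<in> borel_measurable (borel \<Otimes>\<^sub>M borel)"
      by measurable
    then have "(\<lambda>p. if A (\<delta> * fst p) (\<delta> * snd p) then ennreal (gap_weight (n - 2) p) else 0)
        \<in> borel_measurable (lborel \<Otimes>\<^sub>M lborel)"
      by (simp add: lborel_prod borel_prod)
    then show ?thesis
      by (subst lborel.nn_integral_fst[symmetric]) simp_all
  qed
  finally show ?thesis
    unfolding uniform_params_def U_def F_def G_def .
qed

lemma uniform_params_AE_inj:
  assumes "\<delta> > 0"
  shows "AE \<omega> in uniform_params n \<delta>. inj_on \<omega> {..<n}"
proof -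
  let ?U = "uniform_interval \<delta>"
  have "AE \<omega> in uniform_params n \<delta>. \<omega> i \<noteq> \<omega> j" if ij: "i < n" "j < n" "i \<noteq> j" for i j
  proof -
    have "(\<integral>\<^sup>+\<omega>. (if \<omega> i = \<omega> j then 1 else 0) * (\<Prod>k\<in>{..<n} - {i, j}. 1) \<partial>PiM {..<n} (\<lambda>_. ?U))
      = (\<integral>\<^sup>+s. \<integral>\<^sup>+t. (if s = t then 1 else 0) * (\<integral>\<^sup>+x. 1 \<partial>?U) ^ (card {..<n} - 2) \<partial>?U \<partial>?U)"
    proof (rule nn_integral_PiM_two_coordinates[OF prob_space_uniform_interval[OF assms]])
      have "(\<lambda>p. if fst p = snd p then 1 else 0 :: ennreal) \<in> borel_measurable (?U \<Otimes>\<^sub>M ?U)"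
        by measurable
      then show "(\<lambda>(s, t). if s = t then 1 else 0 :: ennreal) \<in> borel_measurable (?U \<Otimes>\<^sub>M ?U)"
        by (simp add: case_prod_beta')
    qed (use ij in auto)
    also have "\<dots> = 0"
    proof -
      have "(\<integral>\<^sup>+t. (if s = t then 1 else 0) * (\<integral>\<^sup>+x. 1 \<partial>?U) ^ (card {..<n} - 2) \<partial>?U) = 0" for s
      proof -
        have "(\<integral>\<^sup>+t. (if s = t then 1 else 0) * (\<integral>\<^sup>+x. 1 \<partial>?U) ^ (card {..<n} - 2) \<partial>?U)
          = ennreal (1/2) * (\<integral>\<^sup>+t. (if s = \<delta> * t then 1 else 0) * (\<integral>\<^sup>+x. 1 \<partial>?U) ^ (card {..<n} - 2) * indicator {-1..1} t \<partial>lborel)"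
          by (rule nn_integral_uniform_interval[OF assms]) measurable
        also have "(\<integral>\<^sup>+t. (if s = \<delta> * t then 1 else 0) * (\<integral>\<^sup>+x. 1 \<partial>?U) ^ (card {..<n} - 2) * indicator {-1..1} t \<partial>lborel)
          = (\<integral>\<^sup>+t. 0 \<partial>(lborel :: real measure))"
        proof (rule nn_integral_cong_AE)
          have "AE t in lborel. t \<noteq> s / \<delta>"
            by (rule AE_lborel_singleton)
          then show "AE t in lborel. (if s = \<delta> * t then 1 else 0) * (\<integral>\<^sup>+x. 1 \<partial>?U) ^ (card {..<n} - 2) * indicator {-1..1} t = (0::ennreal)"
            by (rule eventually_mono) (use assms in auto)
        qed
        finally show ?thesis by simp
      qed
      then show ?thesis by simp
    qed
    finally have "(\<integral>\<^sup>+\<omega>. (if \<omega> i = \<omega> j then 1 else 0) \<partial>PiM {..<n} (\<lambda>_. ?U)) = 0"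
      by simp
    moreover have "(\<lambda>\<omega>. if \<omega> i = \<omega> j then 1 else 0 :: ennreal) \<in> borel_measurable (PiM {..<n} (\<lambda>_. ?U))"
      using ij unfolding uniform_params_def[symmetric] by measurable
    ultimately have "AE \<omega> in PiM {..<n} (\<lambda>_. ?U). (if \<omega> i = \<omega> j then 1 else 0 :: ennreal) = 0"
      by (subst nn_integral_0_iff_AE[symmetric]) auto
    then show ?thesis
      unfolding uniform_params_def by (rule eventually_mono) (auto split: if_splits)
  qed
  then have "AE \<omega> in uniform_params n \<delta>. \<forall>i\<in>{..<n}. \<forall>j\<in>{..<n} - {i}. \<omega> i \<noteq> \<omega> j"
    by (intro AE_finite_allI) auto
  then show ?thesis
    by (rule eventually_mono) (auto simp: inj_on_def)
qed

text \<open>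
  There are \<open>n (n - 1)\<close> ordered pairs of indices, and by exchangeability each contributes the same
  amount. The curve is required to be continuous on the whole line so that
  the integrand is Borel measurable in the plane.
\<close>

lemma expected_num_stable:
  assumes \<delta>: "\<delta> > 0" and r: "continuous_on UNIV r"
  shows "(\<integral>\<^sup>+\<omega>. of_nat (num_stable (random_polygon r n \<omega>)) \<partial>uniform_params n \<delta>)
       = ennreal (real (n * (n - 1)) / 4)
         * (\<integral>\<^sup>+p. (if stable_on_segment (r (\<delta> * fst p)) (r (\<delta> * snd p)) then ennreal (gap_weight (n - 2) p) else 0)
            \<partial>(lborel \<Otimes>\<^sub>M lborel))" (is "_ = _ * ?J")
proof -
  let ?A = "\<lambda>s t. stable_on_segment (r s) (r t)"
  let ?Q = "{(i, j). i < n \<and> j < n \<and> i \<noteq> j}"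
  let ?f = "\<lambda>i j \<omega>. (if \<omega> i < \<omega> j \<and> ?A (\<omega> i) (\<omega> j) then 1 else 0)
          * (\<Prod>k\<in>{..<n} - {i, j}. if \<omega> i < \<omega> k \<and> \<omega> k < \<omega> j then 0 else 1 :: ennreal)"
  have [measurable]: "r \<in> borel_measurable borel"
    by (rule borel_measurable_continuous_onI[OF r])
  have A [measurable]: "Measurable.pred (borel \<Otimes>\<^sub>M borel) (\<lambda>(s, t). ?A s t)"
    unfolding stable_on_segment_def by measurable
  have "(\<integral>\<^sup>+\<omega>. of_nat (num_stable (random_polygon r n \<omega>)) \<partial>uniform_params n \<delta>)
      = (\<integral>\<^sup>+\<omega>. (\<Sum>(i, j)\<in>?Q. ?f i j \<omega>) \<partial>uniform_params n \<delta>)"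
    by (intro nn_integral_cong_AE eventually_mono[OF uniform_params_AE_inj[OF \<delta>]])
       (simp only: num_stable_random_polygon card_pairs_as_sum[where A="?A"])
  also have "\<dots> = (\<Sum>(i, j)\<in>?Q. \<integral>\<^sup>+\<omega>. ?f i j \<omega> \<partial>uniform_params n \<delta>)"
  proof -
    have "?f i j \<in> borel_measurable (uniform_params n \<delta>)" if "i < n" "j < n" for i j
    proof -
      have "(\<lambda>\<omega>. if \<omega> i < \<omega> k \<and> \<omega> k < \<omega> j then 0 else 1 :: ennreal) \<in> borel_measurable (uniform_params n \<delta>)"
        if "k < n" for k using that \<open>i < n\<close> \<open>j < n\<close> by measurable
      moreover have "(\<lambda>\<omega>. if \<omega> i < \<omega> j \<and> ?A (\<omega> i) (\<omega> j) then 1 else 0 :: ennreal) \<in> borel_measurable (uniform_params n \<delta>)"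
        using that by measurable
      ultimately show ?thesis
        by (intro borel_measurable_times_ennreal borel_measurable_prod_ennreal) auto
    qed
    then show ?thesis
      unfolding case_prod_beta' by (intro nn_integral_sum) auto
  qed
  also have "\<dots> = (\<Sum>(i, j)\<in>?Q. ennreal (1/4) * ?J)"
    by (intro sum.cong) (auto intro!: expected_pair_consecutive[OF \<delta> _ _ _ A])
  also have "\<dots> = of_nat (card ?Q) * (ennreal (1/4) * ?J)"
    by simp
  also have "card ?Q = n * (n - 1)"
  proof -
    have "?Q = (SIGMA i:{..<n}. {..<n} - {i})" by auto
    then show ?thesis by (simp add: card_SigmaI)
  qed
  also have "of_nat (n * (n - 1)) * (ennreal (1/4) * ?J) = ennreal (real (n * (n - 1)) / 4) * ?J"
    by (simp only: ennreal_of_nat_eq_real_of_nat mult.assoc[symmetric])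
       (simp flip: ennreal_mult)
  finally show ?thesis .
qed

section \<open>Stability of short sides near the equilibrium\<close>

text \<open>
  A limit of difference quotients at \<open>0\<close>, read along the ray \<open>\<delta> \<mapsto> \<delta> * u\<close>. For \<open>u = 0\<close> the ray
  stays at the origin, where the limit says nothing and \<open>f 0 = 0\<close> takes over.
\<close>

lemma scaled_tendsto:
  fixes f :: "real \<Rightarrow> real"
  assumes f: "((\<lambda>h. f h / h ^ k) \<longlongrightarrow> l) (at 0)" and 0: "f 0 = 0" and k: "k > 0"
  shows "((\<lambda>\<delta>. f (\<delta> * u) / \<delta> ^ k) \<longlongrightarrow> l * u ^ k) (at_right 0)"
proof (cases "u = 0")
  case True
  then show ?thesis using 0 k by (simp add: zero_power)
next
  case False
  have "((\<lambda>\<delta>. \<delta> * u) \<longlongrightarrow> 0 * u) (at_right 0)"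
    by (intro tendsto_intros)
  then have "filterlim (\<lambda>\<delta>. \<delta> * u) (at 0) (at_right 0)"
    using False by (auto simp: filterlim_at eventually_at_filter)
  from filterlim_compose[OF f this]
  have "((\<lambda>\<delta>. f (\<delta> * u) / (\<delta> * u) ^ k * u ^ k) \<longlongrightarrow> l * u ^ k) (at_right 0)"
    by (intro tendsto_mult tendsto_const)
  then show ?thesis
    by (rule Lim_transform_eventually)
       (use False in \<open>auto simp: eventually_at_filter power_mult_distrib\<close>)
qed

text \<open>
  Dividing the inner products of \<open>r (\<delta> * s)\<close> and \<open>r (\<delta> * t)\<close> with the side by \<open>\<delta>\<^sup>2\<close> leaves quantities
  that converge to \<open>v\<^sup>2 / 2 * (t - s)\<close> times \<open>L (s + t) - (t - s)\<close> and \<open>L (s + t) + (t - s)\<close>. Off the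
  critical lines these limits are nonzero, so their signs are attained for small \<open>\<delta>\<close>.
\<close>

lemma stable_on_small_segment:
  fixes r :: "real \<Rightarrow> real \<times> real"
  assumes r0: "r 0 = (0, \<rho>)" and v: "v \<noteq> 0"
    and x: "((\<lambda>h. fst (r h) / h) \<longlongrightarrow> v) (at 0)"
    and y: "((\<lambda>h. (snd (r h) - \<rho>) / h\<^sup>2) \<longlongrightarrow> \<kappa> * v\<^sup>2 / 2) (at 0)"
    and st: "s < t" and ne: "\<bar>1 + \<kappa> * \<rho>\<bar> * \<bar>s + t\<bar> \<noteq> t - s"
  shows "\<forall>\<^sub>F \<delta> in at_right 0. stable_on_segment (r (\<delta> * s)) (r (\<delta> * t))
           \<longleftrightarrow> \<bar>1 + \<kappa> * \<rho>\<bar> * \<bar>s + t\<bar> < t - s"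
proof -
  define L where "L = 1 + \<kappa> * \<rho>"
  define X where "X u \<delta> = fst (r (\<delta> * u)) / \<delta>" for u \<delta>
  define Y where "Y u \<delta> = (snd (r (\<delta> * u)) - \<rho>) / \<delta>\<^sup>2" for u \<delta>
  have X: "(X u \<longlongrightarrow> v * u) (at_right 0)" for u
    unfolding X_def using scaled_tendsto[of "\<lambda>h. fst (r h)" 1 v u] x r0 by simp
  have Y: "(Y u \<longlongrightarrow> \<kappa> * v\<^sup>2 / 2 * u\<^sup>2) (at_right 0)" for u
    unfolding Y_def using scaled_tendsto[of "\<lambda>h. snd (r h) - \<rho>" 2 "\<kappa> * v\<^sup>2 / 2" u] y r0 by simp
  \<comment> \<open>The inner product of \<open>r (\<delta> * u)\<close> with the side, divided by \<open>\<delta>\<^sup>2\<close>.\<close>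
  define D where "D u \<delta> = X u \<delta> * (X t \<delta> - X s \<delta>) + (\<rho> + \<delta>\<^sup>2 * Y u \<delta>) * (Y t \<delta> - Y s \<delta>)" for u \<delta>
  have D: "r (\<delta> * u) \<bullet> (r (\<delta> * t) - r (\<delta> * s)) = \<delta>\<^sup>2 * D u \<delta>" if "\<delta> > 0" for u \<delta>
  proof -
    have "fst (r (\<delta> * w)) = \<delta> * X w \<delta>" "snd (r (\<delta> * w)) = \<rho> + \<delta>\<^sup>2 * Y w \<delta>" for w
      using that by (simp_all add: X_def Y_def)
    then show ?thesis
      unfolding inner_prod_def fst_diff snd_diff inner_real_def D_def
      by (simp only:) (simp add: power2_eq_square algebra_simps)
  qed
  have lim: "(D u \<longlongrightarrow> v * u * (v * t - v * s)
      + (\<rho> + 0\<^sup>2 * (\<kappa> * v\<^sup>2 / 2 * u\<^sup>2)) * (\<kappa> * v\<^sup>2 / 2 * t\<^sup>2 - \<kappa> * v\<^sup>2 / 2 * s\<^sup>2)) (at_right 0)" for u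
    unfolding D_def by (intro tendsto_intros X Y)
  define V where "V = v\<^sup>2 / 2 * (t - s)"
  have V: "V > 0" using v st by (simp add: V_def)
  have Ds: "(D s \<longlongrightarrow> V * (L * (s + t) - (t - s))) (at_right 0)"
  proof -
    have "v * s * (v * t - v * s)
      + (\<rho> + 0\<^sup>2 * (\<kappa> * v\<^sup>2 / 2 * s\<^sup>2)) * (\<kappa> * v\<^sup>2 / 2 * t\<^sup>2 - \<kappa> * v\<^sup>2 / 2 * s\<^sup>2)
      = V * (L * (s + t) - (t - s))"
      by (simp add: V_def L_def power2_eq_square field_simps)
    then show ?thesis using lim[of s] by (simp only:)
  qed
  have Dt: "(D t \<longlongrightarrow> V * (L * (s + t) + (t - s))) (at_right 0)"
  proof -
    have "v * t * (v * t - v * s)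
      + (\<rho> + 0\<^sup>2 * (\<kappa> * v\<^sup>2 / 2 * t\<^sup>2)) * (\<kappa> * v\<^sup>2 / 2 * t\<^sup>2 - \<kappa> * v\<^sup>2 / 2 * s\<^sup>2)
      = V * (L * (s + t) + (t - s))"
      by (simp add: V_def L_def power2_eq_square field_simps)
    then show ?thesis using lim[of t] by (simp only:)
  qed
  have abs: "\<bar>L\<bar> * \<bar>s + t\<bar> = \<bar>L * (s + t)\<bar>" by (simp add: abs_mult)
  have stable: "stable_on_segment (r (\<delta> * s)) (r (\<delta> * t)) \<longleftrightarrow> D s \<delta> < 0 \<and> 0 < D t \<delta>"
    if "\<delta> > 0" for \<delta>
    unfolding stable_on_segment_def D[OF that] using that
    by (simp add: mult_less_0_iff zero_less_mult_iff)
  have pos: "\<forall>\<^sub>F \<delta> in at_right 0. \<delta> > (0::real)"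
    by (simp add: eventually_at_filter)
  \<comment> \<open>In the last two cases one of the two inequalities already fails strictly in the limit.\<close>
  consider "\<bar>L * (s + t)\<bar> < t - s" | "L * (s + t) > t - s" | "L * (s + t) < - (t - s)"
    using ne abs by (fold L_def) linarith
  then show ?thesis
  proof cases
    case 1
    have "\<forall>\<^sub>F \<delta> in at_right 0. D s \<delta> < 0"
      using 1 V by (intro order_tendstoD(2)[OF Ds]) (auto intro!: mult_pos_neg)
    moreover have "\<forall>\<^sub>F \<delta> in at_right 0. 0 < D t \<delta>"
      using 1 V by (intro order_tendstoD(1)[OF Dt]) (auto intro!: mult_pos_pos)
    ultimately show ?thesis
      using pos by eventually_elim (use 1 abs stable in \<open>auto simp flip: L_def\<close>)
  next
    case 2
    have "\<forall>\<^sub>F \<delta> in at_right 0. 0 < D s \<delta>"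
      using 2 V by (intro order_tendstoD(1)[OF Ds]) (auto intro!: mult_pos_pos)
    then show ?thesis
      using pos by eventually_elim (use 2 abs stable in \<open>auto simp flip: L_def\<close>)
  next
    case 3
    have "\<forall>\<^sub>F \<delta> in at_right 0. D t \<delta> < 0"
      using 3 V by (intro order_tendstoD(2)[OF Dt]) (auto intro!: mult_pos_neg)
    then show ?thesis
      using pos by eventually_elim (use 3 abs stable in \<open>auto simp flip: L_def\<close>)
  qed
qed

text \<open>
  For \<open>s \<noteq> 0\<close> each sign of \<open>s + t\<close> allows at most one \<open>t\<close>. The value \<open>s = 0\<close> has to be set aside,
  because for \<open>lam = 1\<close> every \<open>t \<ge> 0\<close> solves the equation there.
\<close>

lemma AE_off_critical_lines:
  fixes lam :: real
  assumes "lam > 0"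
  shows "AE p in lborel \<Otimes>\<^sub>M lborel. lam * \<bar>fst p + snd p\<bar> \<noteq> snd p - fst p"
proof (rule lborel_pair.AE_pair_measure)
  have "{p \<in> space (borel \<Otimes>\<^sub>M borel). lam * \<bar>fst p + snd p\<bar> \<noteq> snd p - fst p} \<in> sets (borel \<Otimes>\<^sub>M borel)"
    by measurable
  then show "{p \<in> space (lborel \<Otimes>\<^sub>M lborel). lam * \<bar>fst p + snd p\<bar> \<noteq> snd p - fst p} \<in> sets (lborel \<Otimes>\<^sub>M lborel)"
    by (simp add: lborel_prod borel_prod)
  have "AE s in lborel. s \<noteq> (0::real)"
    by (rule AE_lborel_singleton)
  then show "AE s in lborel. AE t in lborel. lam * \<bar>fst (s, t) + snd (s, t)\<bar> \<noteq> snd (s, t) - fst (s, t)"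
  proof (rule eventually_mono)
    fix s :: real assume s: "s \<noteq> 0"
    have 1: "AE t in lborel. t \<noteq> s * (1 + lam) / (1 - lam)" and 2: "AE t in lborel. t \<noteq> s * (1 - lam) / (1 + lam)"
      by (rule AE_lborel_singleton)+
    from 1 2 show "AE t in lborel. lam * \<bar>fst (s, t) + snd (s, t)\<bar> \<noteq> snd (s, t) - fst (s, t)"
    proof eventually_elim
      case (elim t)
      show ?case
      proof
        assume *: "lam * \<bar>fst (s, t) + snd (s, t)\<bar> = snd (s, t) - fst (s, t)"
        show False
        proof (cases "s + t \<ge> 0")
          case True
          then have e: "t * (1 - lam) = s * (1 + lam)" using * by (simp add: algebra_simps)
          have "lam \<noteq> 1" using e s by auto
          then have "t = s * (1 + lam) / (1 - lam)" using e by (simp add: field_simps)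
          then show False using elim by simp
        next
          case False
          then have "t * (1 + lam) = s * (1 - lam)" using * by (simp add: algebra_simps)
          then have "t = s * (1 - lam) / (1 + lam)" using assms by (simp add: field_simps)
          then show False using elim by simp
        qed
      qed
    qed
  qed
qed

section \<open>The limiting integral\<close>

text \<open>
  The two terms of the minimum agree at \<open>c = lam / (1 + lam)\<close>, and on either side of it the integrand
  is a combination of powers of \<open>1 - e\<close>.
\<close>

lemma has_integral_power_times_min:
  fixes lam :: real
  assumes "lam > 0"
  shows "((\<lambda>e. (1 - e) ^ m * min (e / lam) (1 - e)) has_integral
           (1 - 1 / (1 + lam) ^ (m + 1)) / (real ((m + 1) * (m + 2)) * lam)) {0..1}"
proof -
  define c where "c = lam / (1 + lam)"
  have c: "0 \<le> c" "c \<le> 1" using assms by (auto simp: c_def)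
  have min: "min (e / lam) (1 - e) = (if e \<le> c then e / lam else 1 - e)" for e
  proof -
    have "e / lam \<le> 1 - e \<longleftrightarrow> e \<le> (1 - e) * lam"
      using assms by (rule pos_divide_le_eq)
    also have "\<dots> \<longleftrightarrow> e * (1 + lam) \<le> lam"
      by (simp add: algebra_simps)
    also have "\<dots> \<longleftrightarrow> e \<le> c"
      unfolding c_def using assms by (intro pos_le_divide_eq[symmetric]) simp
    finally show ?thesis by (simp only: min_def)
  qed
  have minc: "c / lam = 1 - c"
  proof -
    have "1 - c = 1 / (1 + lam)" using assms by (simp add: c_def divide_simps)
    then show ?thesis using assms by (simp add: c_def)
  qed
  define F where "F e = (- ((1 - e) ^ (m + 1) / (m + 1)) + (1 - e) ^ (m + 2) / (m + 2)) / lam" for e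
  define H where "H e = - ((1 - e) ^ (m + 2) / (m + 2))" for e :: real
  have dF: "(F has_real_derivative (1 - e) ^ m * (e / lam)) (at e within S)" for e S
  proof -
    have "(F has_real_derivative ((1 - e) ^ m - (1 - e) ^ (m + 1)) / lam) (at e within S)"
      unfolding F_def
      by (rule derivative_eq_intros refl | use assms in simp)+
    also have "((1 - e) ^ m - (1 - e) ^ (m + 1)) / lam = (1 - e) ^ m * (e / lam)"
      by (simp add: field_simps)
    finally show ?thesis .
  qed
  have dH: "(H has_real_derivative (1 - e) ^ m * (1 - e)) (at e within S)" for e S
    unfolding H_def
    by (rule derivative_eq_intros refl | simp)+
  have "((\<lambda>e. (1 - e) ^ m * (e / lam)) has_integral (F c - F 0)) {0..c}"
    by (rule fundamental_theorem_of_calculus[OF c(1)])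
       (use dF in \<open>auto simp flip: has_real_derivative_iff_has_vector_derivative\<close>)
  then have 1: "((\<lambda>e. (1 - e) ^ m * min (e / lam) (1 - e)) has_integral (F c - F 0)) {0..c}"
    by (rule has_integral_eq[rotated]) (auto simp: min)
  have "((\<lambda>e. (1 - e) ^ m * (1 - e)) has_integral (H 1 - H c)) {c..1}"
    by (rule fundamental_theorem_of_calculus[OF c(2)])
       (use dH in \<open>auto simp flip: has_real_derivative_iff_has_vector_derivative\<close>)
  then have 2: "((\<lambda>e. (1 - e) ^ m * min (e / lam) (1 - e)) has_integral (H 1 - H c)) {c..1}"
    by (rule has_integral_eq[rotated]) (use minc in \<open>auto simp: min\<close>)
  have "((\<lambda>e. (1 - e) ^ m * min (e / lam) (1 - e)) has_integral (F c - F 0 + (H 1 - H c))) {0..1}"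
    by (rule has_integral_combine[OF c 1 2])
  also have "F c - F 0 + (H 1 - H c) = (1 - 1 / (1 + lam) ^ (m + 1)) / (real ((m + 1) * (m + 2)) * lam)"
  proof -
    define Q where "Q = 1 / (1 + lam) ^ (m + 1)"
    have c': "1 - c = 1 / (1 + lam)" using assms by (simp add: c_def field_simps)
    have Q: "(1 - c) ^ (m + 1) = Q" "(1 - c) ^ (m + 2) = Q / (1 + lam)"
      by (simp_all add: c' Q_def power_divide)
    have "F c - F 0 + (H 1 - H c)
      = (- Q / (m + 1) + Q / (1 + lam) / (m + 2)) / lam - (- 1 / (m + 1) + 1 / (m + 2)) / lam
        + Q / (1 + lam) / (m + 2)"
      unfolding F_def H_def Q by simp
    also have "\<dots> = (1 - Q) / (real ((m + 1) * (m + 2)) * lam)"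
    proof -
      define a where "a = real m + 1"
      define b where "b = real m + 2"
      have "a > 0" "b > 0" "b = a + 1" by (auto simp: a_def b_def)
      moreover have "1 + lam \<noteq> 0" using assms by simp
      moreover have "real ((m + 1) * (m + 2)) = a * b" "real (m + 1) = a" "real (m + 2) = b"
        by (simp_all add: a_def b_def algebra_simps)
      moreover have "(- Q / a + Q / (1 + lam) / b) / lam - (- 1 / a + 1 / b) / lam + Q / (1 + lam) / b
          = (1 - Q) / (a * b * lam)"
      proof -
        have "Q / (1 + lam) / b / lam + Q / (1 + lam) / b = Q / b / lam"
          using \<open>1 + lam \<noteq> 0\<close> assms \<open>b > 0\<close> by (simp add: divide_simps) (simp add: algebra_simps)
        then have "(- Q / a + Q / (1 + lam) / b) / lam - (- 1 / a + 1 / b) / lam + Q / (1 + lam) / b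
          = (1 - Q) * (1 / a - 1 / b) / lam"
          by (simp add: add_divide_distrib diff_divide_distrib algebra_simps)
        also have "1 / a - 1 / b = 1 / (a * b)"
          using \<open>a > 0\<close> \<open>b > 0\<close> \<open>b = a + 1\<close> by (simp add: field_simps)
        finally show ?thesis by simp
      qed
      ultimately show ?thesis by simp
    qed
    finally show ?thesis by (simp add: Q_def)
  qed
  finally show ?thesis .
qed

text \<open>
  The substitution \<open>t = s + 2 * e\<close> makes the weight a function of \<open>e\<close> alone. The condition on \<open>s\<close>
  becomes \<open>\<bar>s + e\<bar> < e / lam\<close> and \<open>\<bar>s + e\<bar> \<le> 1 - e\<close>, an interval of length \<open>2 * min (e / lam) (1 - e)\<close>.
\<close>

lemma gap_weight_integral:
  fixes lam :: real
  assumes lam: "lam > 0"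
  shows "(\<integral>\<^sup>+p. (if lam * \<bar>fst p + snd p\<bar> < snd p - fst p then ennreal (gap_weight m p) else 0)
            \<partial>(lborel \<Otimes>\<^sub>M lborel))
       = ennreal (4 * ((1 - 1 / (1 + lam) ^ (m + 1)) / (real ((m + 1) * (m + 2)) * lam)))"
proof -
  define h where "h s t = (if lam * \<bar>s + t\<bar> < t - s then ennreal (gap_weight m (s, t)) else 0)" for s t
  define K where "K = (1 - 1 / (1 + lam) ^ (m + 1)) / (real ((m + 1) * (m + 2)) * lam)"
  define f where "f e = (1 - e) ^ m * min (e / lam) (1 - e)" for e
  have h [measurable]: "(\<lambda>(s, t). h s t) \<in> borel_measurable (borel \<Otimes>\<^sub>M borel)"
    unfolding h_def by measurable
  have slice: "(\<integral>\<^sup>+s. h s (s + 2 * e) \<partial>lborel) = ennreal 2 * (ennreal (f e) * indicator {0..1} e)" for e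
  proof (cases "0 < e \<and> e \<le> 1")
    case True
    \<comment> \<open>The shorter of the two intervals; only the first bound on \<open>s + e\<close> is strict.\<close>
    define S where "S = (if e / lam \<le> 1 - e then {-e - e / lam<..<-e + e / lam} else {-1..1 - 2 * e})"
    have f: "0 \<le> f e" "0 \<le> e / lam" using True lam by (auto simp: f_def)
    have S: "s \<in> S \<longleftrightarrow> lam * \<bar>s + (s + 2 * e)\<bar> < 2 * e \<and> -1 \<le> s \<and> s + 2 * e \<le> 1" for s
    proof -
      have "lam * \<bar>s + (s + 2 * e)\<bar> < 2 * e \<longleftrightarrow> \<bar>s + e\<bar> < e / lam"
      proof -
        have "\<bar>s + (s + 2 * e)\<bar> = 2 * \<bar>s + e\<bar>"
          using abs_mult[of 2 "s + e"] by (simp add: algebra_simps)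
        then show ?thesis using lam by (simp add: field_simps)
      qed
      then show ?thesis
        unfolding S_def by (auto simp: abs_less_iff)
    qed
    have "(\<integral>\<^sup>+s. h s (s + 2 * e) \<partial>lborel) = (\<integral>\<^sup>+s. ennreal ((1 - e) ^ m) * indicator S s \<partial>lborel)"
      by (intro nn_integral_cong) (use True S in \<open>auto simp: h_def gap_weight_def indicator_def\<close>)
    also have "\<dots> = ennreal ((1 - e) ^ m) * emeasure lborel S"
      by (rule nn_integral_cmult_indicator) (simp add: S_def)
    also have "emeasure lborel S = ennreal (2 * min (e / lam) (1 - e))"
      using True lam f(2) by (simp add: S_def)
    also have "ennreal ((1 - e) ^ m) * \<dots> = ennreal (2 * f e)"
      using True f by (simp add: f_def ac_simps flip: ennreal_mult)
    finally show ?thesis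
      using True f by (simp add: ennreal_mult)
  next
    case False
    then have "h s (s + 2 * e) = 0" for s
      by (auto simp: h_def gap_weight_def)
    moreover have "ennreal (f e) * indicator {0..1} e = 0"
      using False lam by (cases "e = 0") (auto simp: f_def)
    ultimately show ?thesis by simp
  qed
  have "(\<integral>\<^sup>+p. (if lam * \<bar>fst p + snd p\<bar> < snd p - fst p then ennreal (gap_weight m p) else 0)
            \<partial>(lborel \<Otimes>\<^sub>M lborel)) = (\<integral>\<^sup>+p. case_prod h p \<partial>(lborel \<Otimes>\<^sub>M lborel))"
    by (intro nn_integral_cong) (auto simp: h_def)
  also have "\<dots> = (\<integral>\<^sup>+s. \<integral>\<^sup>+t. h s t \<partial>lborel \<partial>lborel)"
    using h by (subst lborel.nn_integral_fst[symmetric]) (simp_all add: lborel_prod borel_prod)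
  also have "\<dots> = (\<integral>\<^sup>+s. ennreal 2 * (\<integral>\<^sup>+e. h s (s + 2 * e) \<partial>lborel) \<partial>lborel)"
  proof (intro nn_integral_cong)
    fix s
    show "(\<integral>\<^sup>+t. h s t \<partial>lborel) = ennreal 2 * (\<integral>\<^sup>+e. h s (s + 2 * e) \<partial>lborel)"
      by (subst nn_integral_real_affine[where c=2 and t=s]) auto
  qed
  also have "\<dots> = ennreal 2 * (\<integral>\<^sup>+s. \<integral>\<^sup>+e. h s (s + 2 * e) \<partial>lborel \<partial>lborel)"
    by (rule nn_integral_cmult) measurable
  also have "(\<integral>\<^sup>+s. \<integral>\<^sup>+e. h s (s + 2 * e) \<partial>lborel \<partial>lborel) = (\<integral>\<^sup>+e. \<integral>\<^sup>+s. h s (s + 2 * e) \<partial>lborel \<partial>lborel)"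
    by (rule lborel_pair.Fubini'[symmetric]) measurable
  also have "\<dots> = ennreal 2 * (\<integral>\<^sup>+e. ennreal (f e) * indicator {0..1} e \<partial>lborel)"
    unfolding slice by (rule nn_integral_cmult) (simp add: f_def)
  also have "(\<integral>\<^sup>+e. ennreal (f e) * indicator {0..1} e \<partial>lborel) = ennreal K"
    by (rule nn_integral_has_integral_lebesgue')
       (use has_integral_power_times_min[OF lam, of m] lam in \<open>auto simp: f_def K_def\<close>)
  also have "ennreal 2 * (ennreal 2 * ennreal K) = ennreal (4 * K)"
  proof -
    have "0 \<le> K"
      by (rule has_integral_nonneg[OF has_integral_power_times_min[OF lam, of m, folded K_def]])
         (use lam in auto)
    then show ?thesis by (simp add: ennreal_mult')
  qed
  finally show ?thesis by (simp add: K_def)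
qed

section \<open>The limit of the mean\<close>

text \<open>
  Only the values of the curve on \<open>[-\<delta>, \<delta>]\<close> matter, so the curve may be exchanged for an extension
  \<open>R\<close> that is continuous on the whole line.
\<close>

lemma mean_zeta:
  fixes r R :: "real \<Rightarrow> real \<times> real"
  assumes \<delta>: "\<delta> > 0" and r: "continuous_on {-\<delta>..\<delta>} r" and R: "continuous_on UNIV R"
    and eq: "\<And>x. x \<in> {-\<delta>..\<delta>} \<Longrightarrow> R x = r x"
  shows "(\<integral>k. real k \<partial>zeta r n \<delta>) = enn2real (ennreal (real (n * (n - 1)) / 4)
         * (\<integral>\<^sup>+p. (if stable_on_segment (R (\<delta> * fst p)) (R (\<delta> * snd p)) then ennreal (gap_weight (n - 2) p) else 0)
            \<partial>(lborel \<Otimes>\<^sub>M lborel)))"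
proof -
  have [measurable]: "(\<lambda>\<omega>. num_stable (random_polygon r n \<omega>)) \<in> measurable (uniform_params n \<delta>) (count_space UNIV)"
    by (rule measurable_num_stable[OF r])
  have "(\<integral>k. real k \<partial>zeta r n \<delta>) = (\<integral>\<omega>. real (num_stable (random_polygon r n \<omega>)) \<partial>uniform_params n \<delta>)"
    unfolding zeta_def by (rule integral_distr) simp_all
  also have "\<dots> = enn2real (\<integral>\<^sup>+\<omega>. ennreal (real (num_stable (random_polygon r n \<omega>))) \<partial>uniform_params n \<delta>)"
    by (rule integral_eq_nn_integral)
       (auto intro: measurable_compose[OF measurable_num_stable[OF r]])
  also have "(\<integral>\<^sup>+\<omega>. ennreal (real (num_stable (random_polygon r n \<omega>))) \<partial>uniform_params n \<delta>)
      = (\<integral>\<^sup>+\<omega>. of_nat (num_stable (random_polygon R n \<omega>)) \<partial>uniform_params n \<delta>)"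
  proof (rule nn_integral_cong)
    fix \<omega> assume "\<omega> \<in> space (uniform_params n \<delta>)"
    then have "\<omega> i \<in> {-\<delta>..\<delta>}" if "i < n" for i
      using that by (auto simp: uniform_params_def space_PiM PiE_iff)
    then have "random_polygon r n \<omega> = random_polygon R n \<omega>"
      unfolding random_polygon_def by (intro map_cong refl) (auto simp: eq)
    then show "ennreal (real (num_stable (random_polygon r n \<omega>))) = of_nat (num_stable (random_polygon R n \<omega>))"
      by (simp add: ennreal_of_nat_eq_real_of_nat)
  qed
  also note expected_num_stable[OF \<delta> R]
  finally show ?thesis .
qed

text \<open>
  The weights are at most \<open>1\<close> and vanish outside the square \<open>[-1, 1] \<times> [-1, 1]\<close>, whose indicator
  serves as the integrable bound.
\<close>

lemma tendsto_pair_integral: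
  fixes R :: "real \<Rightarrow> real \<times> real"
  assumes R: "continuous_on UNIV R" and r0: "R 0 = (0, \<rho>)" and v: "v \<noteq> 0"
    and x: "((\<lambda>h. fst (R h) / h) \<longlongrightarrow> v) (at 0)"
    and y: "((\<lambda>h. (snd (R h) - \<rho>) / h\<^sup>2) \<longlongrightarrow> \<kappa> * v\<^sup>2 / 2) (at 0)"
    and ne: "1 + \<kappa> * \<rho> \<noteq> 0"
    and d: "filterlim d (at_right 0) sequentially"
  shows "(\<lambda>k. \<integral>\<^sup>+p. (if stable_on_segment (R (d k * fst p)) (R (d k * snd p))
              then ennreal (gap_weight m p) else 0) \<partial>(lborel \<Otimes>\<^sub>M lborel))
     \<longlonglongrightarrow> (\<integral>\<^sup>+p. (if \<bar>1 + \<kappa> * \<rho>\<bar> * \<bar>fst p + snd p\<bar> < snd p - fst p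
              then ennreal (gap_weight m p) else 0) \<partial>(lborel \<Otimes>\<^sub>M lborel))"
proof (rule nn_integral_dominated_convergence[where w="\<lambda>p. indicator ({-1..1} \<times> {-1..1}) p"])
  have [measurable]: "R \<in> borel_measurable borel"
    by (rule borel_measurable_continuous_onI[OF R])
  have "(\<lambda>p. if stable_on_segment (R (d k * fst p)) (R (d k * snd p)) then ennreal (gap_weight m p) else 0)
      \<in> borel_measurable (borel \<Otimes>\<^sub>M borel)" for k
    unfolding stable_on_segment_def by measurable
  then show "(\<lambda>p. if stable_on_segment (R (d k * fst p)) (R (d k * snd p)) then ennreal (gap_weight m p) else 0)
      \<in> borel_measurable (lborel \<Otimes>\<^sub>M lborel)" for k
    by (simp add: lborel_prod borel_prod)
  have "(\<lambda>p. if \<bar>1 + \<kappa> * \<rho>\<bar> * \<bar>fst p + snd p\<bar> < snd p - fst p then ennreal (gap_weight m p) else 0)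
      \<in> borel_measurable (borel \<Otimes>\<^sub>M borel)"
    by measurable
  then show "(\<lambda>p. if \<bar>1 + \<kappa> * \<rho>\<bar> * \<bar>fst p + snd p\<bar> < snd p - fst p then ennreal (gap_weight m p) else 0)
      \<in> borel_measurable (lborel \<Otimes>\<^sub>M lborel)"
    by (simp add: lborel_prod borel_prod)
  show "(\<lambda>p. indicator ({-1..1} \<times> {-1..1}) p :: ennreal) \<in> borel_measurable ((lborel :: real measure) \<Otimes>\<^sub>M (lborel :: real measure))"
    by (intro borel_measurable_indicator pair_measureI) auto
  show "(\<integral>\<^sup>+p. indicator ({-1..1} \<times> {-1..1}) p \<partial>((lborel :: real measure) \<Otimes>\<^sub>M (lborel :: real measure))) < \<infinity>"
    by (simp add: lborel.emeasure_pair_measure_Times flip: ennreal_mult)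
  show "AE p in lborel \<Otimes>\<^sub>M lborel. (if stable_on_segment (R (d k * fst p)) (R (d k * snd p))
              then ennreal (gap_weight m p) else 0) \<le> indicator ({-1..1} \<times> {-1..1}) p" for k
  proof (rule AE_I2)
    fix p :: "real \<times> real"
    have "ennreal (gap_weight m p) \<le> ennreal (indicator ({-1..1} \<times> {-1..1}) p)"
      by (rule ennreal_leI[OF gap_weight_bounds(2)])
    then show "(if stable_on_segment (R (d k * fst p)) (R (d k * snd p))
              then ennreal (gap_weight m p) else 0) \<le> indicator ({-1..1} \<times> {-1..1}) p"
      by (simp add: ennreal_indicator)
  qed
  have "AE p in lborel \<Otimes>\<^sub>M lborel. \<bar>1 + \<kappa> * \<rho>\<bar> * \<bar>fst p + snd p\<bar> \<noteq> snd p - fst p"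
    using ne by (intro AE_off_critical_lines) simp
  then show "AE p in lborel \<Otimes>\<^sub>M lborel.
      (\<lambda>k. if stable_on_segment (R (d k * fst p)) (R (d k * snd p)) then ennreal (gap_weight m p) else 0)
      \<longlonglongrightarrow> (if \<bar>1 + \<kappa> * \<rho>\<bar> * \<bar>fst p + snd p\<bar> < snd p - fst p then ennreal (gap_weight m p) else 0)"
  proof (rule eventually_mono)
    fix p :: "real \<times> real"
    assume *: "\<bar>1 + \<kappa> * \<rho>\<bar> * \<bar>fst p + snd p\<bar> \<noteq> snd p - fst p"
    show "(\<lambda>k. if stable_on_segment (R (d k * fst p)) (R (d k * snd p)) then ennreal (gap_weight m p) else 0)
      \<longlonglongrightarrow> (if \<bar>1 + \<kappa> * \<rho>\<bar> * \<bar>fst p + snd p\<bar> < snd p - fst p then ennreal (gap_weight m p) else 0)"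
    proof (cases "fst p < snd p")
      case True
      have "\<forall>\<^sub>F k in sequentially. stable_on_segment (R (d k * fst p)) (R (d k * snd p))
           \<longleftrightarrow> \<bar>1 + \<kappa> * \<rho>\<bar> * \<bar>fst p + snd p\<bar> < snd p - fst p"
        by (rule eventually_compose_filterlim[OF stable_on_small_segment[OF r0 v x y True *] d])
      then show ?thesis
        by (rule tendsto_eventually[OF eventually_mono]) simp
    next
      case False
      then have "gap_weight m p = 0"
        by (auto simp: gap_weight_def split: prod.splits)
      then show ?thesis by (simp cong: if_cong)
    qed
  qed
qed

text \<open>
  One application of L'Hopital's rule reduces the claim to the difference quotient of \<open>f'\<close> at \<open>0\<close>.
\<close>

lemma second_order_quotient_tendsto:
  fixes f f' :: "real \<Rightarrow> real"
  assumes ab: "a < 0" "0 < b" and f: "\<And>t. t \<in> {a<..<b} \<Longrightarrow> (f has_real_derivative f' t) (at t)"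
    and f': "(f' has_real_derivative w) (at 0)" "f' 0 = 0"
  shows "((\<lambda>h. (f h - f 0) / h\<^sup>2) \<longlongrightarrow> w / 2) (at 0)"
proof (rule lhopital[where f'=f' and g'="\<lambda>h. 2 * h"])
  have "isCont f 0"
    using f[of 0] ab by (intro DERIV_isCont) auto
  then show "((\<lambda>h. f h - f 0) \<longlongrightarrow> 0) (at 0)"
    by (simp add: isCont_def LIM_zero)
  show "((\<lambda>h::real. h\<^sup>2) \<longlongrightarrow> 0) (at 0)"
    by (auto intro!: tendsto_eq_intros)
  show "\<forall>\<^sub>F h in at 0. h\<^sup>2 \<noteq> (0::real)" "\<forall>\<^sub>F h in at 0. 2 * h \<noteq> (0::real)"
    by (auto simp: eventually_at_filter)
  have "\<forall>\<^sub>F h in at 0. h \<in> {a<..<b}"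
    using ab by (intro eventually_at_in_open') auto
  then show "\<forall>\<^sub>F h in at 0. ((\<lambda>h. f h - f 0) has_real_derivative f' h) (at h)"
    by eventually_elim (auto intro!: derivative_eq_intros f)
  show "\<forall>\<^sub>F h in at 0. ((\<lambda>h. h\<^sup>2) has_real_derivative 2 * h) (at (h::real))"
    by (intro always_eventually allI) (auto intro!: derivative_eq_intros)
  have "((\<lambda>h. f' h / h / 2) \<longlongrightarrow> w / 2) (at 0)"
    using f' by (intro tendsto_divide tendsto_const) (auto simp: DERIV_def)
  then show "((\<lambda>h. f' h / (2 * h)) \<longlongrightarrow> w / 2) (at 0)"
    by (simp add: field_simps)
qed

text \<open>
  The position vector is vertical, hence at an equilibrium the velocity is horizontal and the
  curvature is the second derivative of the ordinate divided by \<open>v\<^sup>2\<close>.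
\<close>

lemma expansion_at_equilibrium:
  fixes r :: "real \<Rightarrow> real \<times> real"
  assumes ab: "a < 0" "0 < b" and C: "C_class_on (Suc (Suc k)) {a..b} r"
    and v: "0 < fst (velocity r {a..b} 0)"
    and r0: "r 0 = (0, \<rho>)" "\<rho> \<noteq> 0" and eq: "r 0 \<bullet> velocity r {a..b} 0 = 0"
  defines "v \<equiv> fst (velocity r {a..b} 0)"
  shows "((\<lambda>h. fst (r h) / h) \<longlongrightarrow> v) (at 0)"
    and "((\<lambda>h. (snd (r h) - \<rho>) / h\<^sup>2) \<longlongrightarrow> signed_curvature r {a..b} 0 * v\<^sup>2 / 2) (at 0)"
proof -
  let ?S = "{a..b}"
  obtain r1 r2 where r1: "\<And>t. t \<in> ?S \<Longrightarrow> (r has_vector_derivative r1 t) (at t within ?S)"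
    and r2: "\<And>t. t \<in> ?S \<Longrightarrow> (r1 has_vector_derivative r2 t) (at t within ?S)"
    using C by (auto simp: Ball_def)
  have vel: "velocity r ?S t = r1 t" if "t \<in> ?S" for t
    unfolding velocity_def using ab that by (intro vector_derivative_within_closed_interval r1) auto
  have 0: "0 \<in> ?S" using ab by auto
  have "(velocity r ?S has_vector_derivative r2 0) (at 0 within ?S)"
    by (rule has_vector_derivative_transform[OF 0 _ r2[OF 0]]) (simp add: vel)
  then have acc: "acceleration r ?S 0 = r2 0"
    unfolding acceleration_def using ab 0 by (intro vector_derivative_within_closed_interval) auto
  have at: "at t within ?S = at t" if "t \<in> {a<..<b}" for t
    using that by (intro at_within_interior) auto
  have d1: "((\<lambda>t. fst (r t)) has_real_derivative fst (r1 t)) (at t)"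
    "((\<lambda>t. snd (r t)) has_real_derivative snd (r1 t)) (at t)"
    "((\<lambda>t. snd (r1 t)) has_real_derivative snd (r2 t)) (at t)" if t: "t \<in> {a<..<b}" for t
    using r1[of t] r2[of t] t unfolding at[OF t] has_real_derivative_iff_has_vector_derivative
    by (auto intro: bounded_linear.has_vector_derivative bounded_linear_fst bounded_linear_snd)
  have s0: "snd (r1 0) = 0"
    using eq r0 vel[OF 0] by (simp add: inner_prod_def)
  have vr: "r1 0 = (v, 0)" using vel[OF 0] s0 by (simp add: v_def prod_eq_iff)
  show "((\<lambda>h. fst (r h) / h) \<longlongrightarrow> v) (at 0)"
    using d1(1)[of 0] ab r0 vr by (simp add: DERIV_def)
  have "v > 0" using v by (simp add: v_def)
  then have "signed_curvature r ?S 0 * v\<^sup>2 = snd (r2 0)"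
    unfolding signed_curvature_def vel[OF 0] acc vr
    by (simp add: norm_Pair power2_eq_square power3_eq_cube)
  then show "((\<lambda>h. (snd (r h) - \<rho>) / h\<^sup>2) \<longlongrightarrow> signed_curvature r ?S 0 * v\<^sup>2 / 2) (at 0)"
    using second_order_quotient_tendsto[OF ab, of "\<lambda>t. snd (r t)" "\<lambda>t. snd (r1 t)" "snd (r2 0)"]
      d1(2) d1(3)[of 0] ab s0 r0 by simp
qed

theorem theorem2:
  fixes r :: "real \<Rightarrow> real \<times> real" and a b \<rho> \<kappa> lam :: real
  assumes "a < 0" and "0 < b"
    and "C_class_on 4 {a..b} r"
    and "inj_on r {a..b}"
    and "\<And>t. t \<in> {a..b} \<Longrightarrow> 0 < fst (velocity r {a..b} t)"
    and "equilibrium_points r {a..b} = {r 0}"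
    and "r 0 = (0, \<rho>)" and "0 < \<rho>"
    and "\<kappa> = signed_curvature r {a..b} 0"
    and "0 \<noteq> 1 + \<kappa> * \<rho>" and "1 + \<kappa> * \<rho> < 1"
    and "lam = \<bar>1 + \<kappa> * \<rho>\<bar>"
  shows "\<forall>n\<ge>2. \<forall>\<epsilon>>0. \<exists>\<delta>. 0 < \<delta> \<and> \<delta> \<le> min \<bar>a\<bar> b \<and>
           \<bar>(\<integral>k. real k \<partial>zeta r n \<delta>) - 1 / lam * (1 - 1 / (1 + lam) ^ (n - 1))\<bar> < \<epsilon>"
proof (intro allI impI)
  fix n :: nat and \<epsilon> :: real
  assume n: "2 \<le> n" and \<epsilon>: "0 < \<epsilon>"
  note ab = assms(1,2)
  have lam: "lam > 0" using assms(10,12) by simp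
  define v where "v = fst (velocity r {a..b} 0)"
  have v: "v \<noteq> 0" using assms(5)[of 0] ab by (simp add: v_def)
  have C: "C_class_on (Suc (Suc (Suc (Suc 0)))) {a..b} r"
    using assms(3) by (simp only: eval_nat_numeral BitM.simps One_nat_def)
  have "r 0 \<in> equilibrium_points r {a..b}" using assms(6) by simp
  then obtain t where t: "t \<in> {a..b}" "r 0 = r t" "r t \<bullet> velocity r {a..b} t = 0"
    by (auto simp: equilibrium_points_def)
  \<comment> \<open>The equilibrium is given as a point of the plane; simplicity of the curve identifies its parameter.\<close>
  have "t = 0" using inj_onD[OF assms(4) t(2)] t(1) ab by auto
  then have eq: "r 0 \<bullet> velocity r {a..b} 0 = 0" using t by simp
  \<comment> \<open>Outside the parameter interval \<open>r\<close> is arbitrary, so it is extended by its values at the ends.\<close>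
  define R where "R t = r (max a (min b t))" for t
  have Rr: "R t = r t" if "t \<in> {a..b}" for t
    using that by (auto simp: R_def max_def min_def)
  have contr: "continuous_on {a..b} r"
  proof -
    from C obtain r1 where "\<forall>t\<in>{a..b}. (r has_vector_derivative r1 t) (at t within {a..b})"
      by auto
    then show ?thesis
      by (auto simp: continuous_on_eq_continuous_within intro: has_vector_derivative_continuous)
  qed
  have contR: "continuous_on UNIV R"
    unfolding R_def using ab
    by (intro continuous_on_compose2[OF contr] continuous_intros) auto
  have R0: "R 0 = (0, \<rho>)" using Rr[of 0] ab assms(7) by simp
  have ev: "\<forall>\<^sub>F h in at 0. R h = r h"
  proof -
    have "\<forall>\<^sub>F h in at 0. h \<in> {a<..<b}"
      using ab by (intro eventually_at_in_open') auto
    then show ?thesis by eventually_elim (auto intro: Rr)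
  qed
  note exp = expansion_at_equilibrium[OF ab C assms(5) assms(7) _ eq, folded v_def assms(9)]
  have x: "((\<lambda>h. fst (R h) / h) \<longlongrightarrow> v) (at 0)"
    by (rule Lim_transform_eventually[OF exp(1)])
       (use ev ab assms(8) in \<open>auto elim!: eventually_mono\<close>)
  have y: "((\<lambda>h. (snd (R h) - \<rho>) / h\<^sup>2) \<longlongrightarrow> \<kappa> * v\<^sup>2 / 2) (at 0)"
    by (rule Lim_transform_eventually[OF exp(2)])
       (use ev ab assms(8) in \<open>auto elim!: eventually_mono\<close>)
  define d where "d k = min \<bar>a\<bar> b * inverse (real (Suc k))" for k
  have d_pos: "0 < d k" for k using ab by (simp add: d_def)
  have d_le: "d k \<le> min \<bar>a\<bar> b" for k
    unfolding d_def using ab by (intro mult_right_le_one_le) (auto simp: inverse_le_1_iff)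
  have "d \<longlonglongrightarrow> min \<bar>a\<bar> b * 0"
    unfolding d_def by (intro tendsto_intros LIMSEQ_inverse_real_of_nat)
  then have d: "filterlim d (at_right 0) sequentially"
    using d_pos by (auto simp: filterlim_at less_imp_neq[THEN not_sym])
  define L where "L = 4 * ((1 - 1 / (1 + lam) ^ (n - 2 + 1)) / (real ((n - 2 + 1) * (n - 2 + 2)) * lam))"
  have L: "real (n * (n - 1)) / 4 * L = 1 / lam * (1 - 1 / (1 + lam) ^ (n - 1))"
  proof -
    define N where "N = real (n * (n - 1))"
    define X where "X = 1 - 1 / (1 + lam) ^ (n - 1)"
    have idx: "n - 2 + 1 = n - 1" "n - 2 + 2 = n" using n by auto
    have "N \<noteq> 0" using n by (simp add: N_def)
    then have "N / 4 * (4 * (X / (N * lam))) = 1 / lam * X"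
      using lam by simp
    then show ?thesis
      unfolding L_def idx N_def X_def by (simp only: mult.commute)
  qed
  have L0: "0 \<le> real (n * (n - 1)) / 4 * L"
    unfolding L using lam by (simp add: field_simps)
  have "(\<lambda>k. (\<integral>\<^sup>+p. (if stable_on_segment (R (d k * fst p)) (R (d k * snd p))
              then ennreal (gap_weight (n - 2) p) else 0) \<partial>(lborel \<Otimes>\<^sub>M lborel)))
     \<longlonglongrightarrow> ennreal L"
    using tendsto_pair_integral[OF contR R0 v x y assms(10)[symmetric] d, of "n - 2"]
    unfolding assms(12)[symmetric] gap_weight_integral[OF lam] L_def .
  then have "(\<lambda>k. ennreal (real (n * (n - 1)) / 4) * (\<integral>\<^sup>+p. (if stable_on_segment (R (d k * fst p)) (R (d k * snd p))
              then ennreal (gap_weight (n - 2) p) else 0) \<partial>(lborel \<Otimes>\<^sub>M lborel)))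
     \<longlonglongrightarrow> ennreal (real (n * (n - 1)) / 4) * ennreal L"
    by (rule ennreal_tendsto_cmult[rotated]) simp
  also have "ennreal (real (n * (n - 1)) / 4) * ennreal L = ennreal (real (n * (n - 1)) / 4 * L)"
    by (rule ennreal_mult'[symmetric]) simp
  finally have "(\<lambda>k. enn2real (ennreal (real (n * (n - 1)) / 4) * (\<integral>\<^sup>+p. (if stable_on_segment (R (d k * fst p)) (R (d k * snd p))
              then ennreal (gap_weight (n - 2) p) else 0) \<partial>(lborel \<Otimes>\<^sub>M lborel))))
     \<longlonglongrightarrow> real (n * (n - 1)) / 4 * L"
    by (rule tendsto_enn2real[OF _ L0])
  moreover have "(\<integral>k. real k \<partial>zeta r n (d k)) = enn2real (ennreal (real (n * (n - 1)) / 4) * (\<integral>\<^sup>+p. (if stable_on_segment (R (d k * fst p)) (R (d k * snd p))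
              then ennreal (gap_weight (n - 2) p) else 0) \<partial>(lborel \<Otimes>\<^sub>M lborel)))" for k
  proof (rule mean_zeta[OF d_pos _ contR])
    have sub: "{- d k..d k} \<subseteq> {a..b}" using d_le[of k] ab by auto
    show "continuous_on {- d k..d k} r" by (rule continuous_on_subset[OF contr sub])
    show "R x = r x" if "x \<in> {- d k..d k}" for x using that sub by (intro Rr) auto
  qed
  ultimately have "(\<lambda>k. \<integral>j. real j \<partial>zeta r n (d k)) \<longlonglongrightarrow> 1 / lam * (1 - 1 / (1 + lam) ^ (n - 1))"
    unfolding L by simp
  from tendstoD[OF this \<epsilon>] obtain k where
    "dist (\<integral>j. real j \<partial>zeta r n (d k)) (1 / lam * (1 - 1 / (1 + lam) ^ (n - 1))) < \<epsilon>"
    by (auto simp: eventually_sequentially)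
  then show "\<exists>\<delta>. 0 < \<delta> \<and> \<delta> \<le> min \<bar>a\<bar> b \<and>
           \<bar>(\<integral>k. real k \<partial>zeta r n \<delta>) - 1 / lam * (1 - 1 / (1 + lam) ^ (n - 1))\<bar> < \<epsilon>"
    using d_pos d_le by (intro exI[of _ "d k"]) (simp only: dist_real_def simp_thms)
qed

end
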